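(* Let $O\mapsto\mathcal A(O)\subset B(\mathcal H)$ be a Haag--Kastler net of von Neumann algebras. (i) Let $O_1\perp O_2$ be a spacelike pair of double cones. For fixed bounded self-adjoint $a\in\mathcal A^d(O_1)$ and $b\in\mathcal A^d(O_2)$, $$\lim_{\substack{(s,t)\to(0,0)\\ st\neq0}}\frac{C_{a,b}(s,t)}{|st|}=\|[D_a,D_b]\|_{\mathrm{cb}}=\operatorname{diam}\sigma(-i[a,b]).$$ (ii) Let $O_1\perp O_2$ be a spacelike pair of double cones. At common scale the convergence is uniform on the two self-adjoint unit balls (i.e. $\varepsilon^{-2}C_{a,b}(\varepsilon,\varepsilon)\to\|[D_a,D_b]\|_{\mathrm{cb}}$ as $\varepsilon\downarrow0$ uniformly in self-adjoint contractions $a\in\mathcal A^d(O_1)$, $b\in\mathcal A^d(O_2)$), and $$\Gamma_{\mathcal A}(O_1,O_2)=\lim_{\varepsilon\downarrow0}\frac1{\varepsilon^2}\sup_{\substack{a=a^*\in\mathcal A^d(O_1),\ \|a\|\le1\\ b=b^*\in\mathcal A^d(O_2),\ \|b\|\le1}}C_{a,b}(\varepsilon,\varepsilon).$$ (iii) $\mathcal A$ satisfies essential duality if and only if $\Gamma_{\mathcal A}(O_1,O_2)=0$ for every spacelike pair $O_1\perp O_2$. (iv) If essential duality fails, then for some spacelike pair $O_1\perp O_2$ there are self-adjoint contractions $a\in\mathcal A^d(O_1)$, $b\in\mathcal A^d(O_2)$ with $c:=\operatorname{diam}\sigma(-i[a,b])>0$ such that for every $\eta\in(0,1)$ there is $\delta>0$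 with $$(1-\eta)c\,|st|\le C_{a,b}(s,t)\le(1+\eta)c\,|st|\qquad\text{whenever }0<|s|,|t|<\delta.$$ The corresponding flows $\operatorname{Ad}_{e^{isa}}$ and $\operatorname{Ad}_{e^{itb}}$ lie in $\mathfrak{NS}_{\mathcal A}(O_1)$ and $\mathfrak{NS}_{\mathcal A}(O_2)$ respectively and converge to the identity in cb norm as $s,t\to0$.
   Context: Net: $O\mapsto\mathcal A(O)\subset B(\mathcal H)$ assigns to each (bounded open) double cone $O$ in Minkowski space a von Neumann algebra on the Hilbert space $\mathcal H$, with isotony ($O_1\subset O_2\Rightarrow\mathcal A(O_1)\subset\mathcal A(O_2)$) and locality ($[\mathcal A(O_1),\mathcal A(O_2)]=0$ whenever $O_1\subset O_2'$, where $O'$ is the causal complement of $O$). One writes $O_1\perp O_2$ (spacelike pair) for $O_1\subset O_2'$. For a general open region $R$, $\mathcal A(R):=\bigvee_{V\subset R}\mathcal A(V)$, the von Neumann algebra generated by all $\mathcal A(V)$ with $V\subset R$ a double cone. The dual net is $\mathcal A^d(O):=\mathcal A(O')'$ (commutant). Essential duality means $[\mathcal A^d(O_1),\mathcal A^d(O_2)]=0$ for every spacelike pair of double cones. $\mathfrak{NS}_{\mathcal A}(O)$ is the class of normal unital completely positive maps on $B(\mathcal H)$ fixing $\mathcal A(O')$ pointwise. $\operatorname{Ad}_u(x)=u^*xu$; $\|\cdot\|_{\mathrm{cb}}$ is the completely bounded norm. For bounded self-adjoint $a,b\in B(\mathcal H)$, $$C_{a,b}(s,t):=\bigl\|\operatorname{Ad}_{e^{isa}}\circ\operatorname{Ad}_{e^{itb}}-\operatorname{Ad}_{e^{itb}}\circ\operatorname{Ad}_{e^{isa}}\bigr\|_{\mathrm{cb}},\qquad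 D_a(x):=-i[a,x],$$ and $[D_a,D_b]=D_a\circ D_b-D_b\circ D_a$. For von Neumann algebras $M,N$, $\Gamma(M,N):=\sup\|[D_a,D_b]\|_{\mathrm{cb}}$ over self-adjoint contractions $a\in M$, $b\in N$, and $\Gamma_{\mathcal A}(O_1,O_2):=\Gamma(\mathcal A^d(O_1),\mathcal A^d(O_2))$. $\sigma(\cdot)$ is the spectrum and $\operatorname{diam}$ the diameter of a subset of $\mathbb R$. *)

theory Defs
  imports "HOL-Analysis.Analysis"
begin

section \<open>Complex Hilbert spaces and their bounded operators\<close>

class scaleC = scaleR +
  fixes scaleC :: "complex \<Rightarrow> 'a \<Rightarrow> 'a"  (infixr "*\<^sub>C" 75)
  assumes scaleR_scaleC: "r *\<^sub>R x = complex_of_real r *\<^sub>C x"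

text \<open>The inner product is antilinear in the first argument. Neither separability nor
  non-triviality of the space is assumed; completeness comes from the class \<open>banach\<close>.\<close>

class complex_hilbert = banach + scaleC +
  fixes cinner :: "'a \<Rightarrow> 'a \<Rightarrow> complex"
  assumes scaleC_add_right: "c *\<^sub>C (x + y) = c *\<^sub>C x + c *\<^sub>C y"
    and scaleC_add_left: "(c + d) *\<^sub>C x = c *\<^sub>C x + d *\<^sub>C x"
    and scaleC_scaleC: "c *\<^sub>C d *\<^sub>C x = (c * d) *\<^sub>C x"
    and cinner_commute: "cinner x y = cnj (cinner y x)"
    and cinner_add_right: "cinner x (y + z) = cinner x y + cinner x z"
    and cinner_scaleC_right: "cinner x (c *\<^sub>C y) = c * cinner x y"
    and cinner_self: "cinner x x = complex_of_real ((norm x)\<^sup>2)"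
begin

lemma cinner_scaleC_left: "cinner (c *\<^sub>C x) y = cnj c * cinner x y"
  using cinner_commute[of "c *\<^sub>C x" y] cinner_commute[of x y] cinner_scaleC_right[of y c x]
  by simp

end

lemma norm_scaleC: "norm (c *\<^sub>C (x::'h::complex_hilbert)) = cmod c * norm x"
proof -
  have "complex_of_real ((norm (c *\<^sub>C x))\<^sup>2) = cnj c * (c * complex_of_real ((norm x)\<^sup>2))"
    by (simp only: cinner_self[symmetric] cinner_scaleC_left cinner_scaleC_right ac_simps)
  also have "\<dots> = complex_of_real ((cmod c)\<^sup>2) * complex_of_real ((norm x)\<^sup>2)"
    by (simp only: complex_norm_square ac_simps)
  also have "\<dots> = complex_of_real ((cmod c * norm x)\<^sup>2)"
    by (simp only: of_real_mult[symmetric] power_mult_distrib)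
  finally have "complex_of_real ((norm (c *\<^sub>C x))\<^sup>2) = complex_of_real ((cmod c * norm x)\<^sup>2)" .
  then have "(norm (c *\<^sub>C x))\<^sup>2 = (cmod c * norm x)\<^sup>2"
    using of_real_eq_iff by blast
  then show ?thesis by (simp add: power2_eq_iff_nonneg)
qed

lemma bounded_linear_scaleC: "bounded_linear (\<lambda>x::'h::complex_hilbert. c *\<^sub>C x)"
proof (rule bounded_linear_intro)
  show "c *\<^sub>C (r *\<^sub>R x) = r *\<^sub>R (c *\<^sub>C x)" for r and x :: 'h
    by (simp only: scaleR_scaleC scaleC_scaleC mult.commute)
  show "norm (c *\<^sub>C x) \<le> norm x * cmod c" for x :: 'h
    by (simp add: norm_scaleC mult.commute)
qed (rule scaleC_add_right)

typedef (overloaded) ('h::complex_hilbert) bounded_op =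
  "{f :: 'h \<Rightarrow>\<^sub>L 'h. \<forall>c x. blinfun_apply f (c *\<^sub>C x) = c *\<^sub>C blinfun_apply f x}"
  morphisms op_blinfun Abs_bounded_op
proof
  show "id_blinfun \<in> {f :: 'h \<Rightarrow>\<^sub>L 'h. \<forall>c x. blinfun_apply f (c *\<^sub>C x) = c *\<^sub>C blinfun_apply f x}"
    by simp
qed

setup_lifting type_definition_bounded_op

lift_definition op_apply :: "'h::complex_hilbert bounded_op \<Rightarrow> 'h \<Rightarrow> 'h" is blinfun_apply .

lemma scaleC_minus_right: "c *\<^sub>C (- x) = - (c *\<^sub>C (x::'h::complex_hilbert))"
  by (rule linear_neg[OF bounded_linear.linear[OF bounded_linear_scaleC]])

lemma scaleC_diff_right: "c *\<^sub>C (x - y) = c *\<^sub>C x - c *\<^sub>C (y::'h::complex_hilbert)"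
  by (rule linear_diff[OF bounded_linear.linear[OF bounded_linear_scaleC]])

lemma scaleC_zero_right [simp]: "c *\<^sub>C (0::'h::complex_hilbert) = 0"
  by (rule linear_0[OF bounded_linear.linear[OF bounded_linear_scaleC]])

text \<open>The norm of \<open>B(H)\<close> is the operator norm; multiplication is composition.\<close>

instantiation bounded_op :: (complex_hilbert) "{real_normed_algebra, monoid_mult, scaleC}"
begin

lift_definition zero_bounded_op :: "'a bounded_op" is 0 by simp
lift_definition one_bounded_op :: "'a bounded_op" is id_blinfun by simp
lift_definition plus_bounded_op :: "'a bounded_op \<Rightarrow> 'a bounded_op \<Rightarrow> 'a bounded_op" is plus
  by (simp add: blinfun.add_left scaleC_add_right)
lift_definition minus_bounded_op :: "'a bounded_op \<Rightarrow> 'a bounded_op \<Rightarrow> 'a bounded_op" is minus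
  by (simp add: blinfun.diff_left scaleC_diff_right)
lift_definition uminus_bounded_op :: "'a bounded_op \<Rightarrow> 'a bounded_op" is uminus
  by (simp add: blinfun.minus_left scaleC_minus_right)
lift_definition times_bounded_op :: "'a bounded_op \<Rightarrow> 'a bounded_op \<Rightarrow> 'a bounded_op"
  is blinfun_compose by simp
lift_definition scaleR_bounded_op :: "real \<Rightarrow> 'a bounded_op \<Rightarrow> 'a bounded_op" is scaleR
  by (simp add: blinfun.scaleR_left scaleR_scaleC scaleC_scaleC mult.commute)
lift_definition scaleC_bounded_op :: "complex \<Rightarrow> 'a bounded_op \<Rightarrow> 'a bounded_op"
  is "\<lambda>c f. Blinfun (\<lambda>x. c *\<^sub>C blinfun_apply f x)"
  by (subst (1 2) bounded_linear_Blinfun_apply)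
     (auto intro: bounded_linear_compose[OF bounded_linear_scaleC] blinfun.bounded_linear_right
       simp: scaleC_scaleC mult.commute)
lift_definition norm_bounded_op :: "'a bounded_op \<Rightarrow> real" is norm .
definition dist_bounded_op :: "'a bounded_op \<Rightarrow> 'a bounded_op \<Rightarrow> real"
  where "dist_bounded_op a b = norm (a - b)"
definition sgn_bounded_op :: "'a bounded_op \<Rightarrow> 'a bounded_op"
  where "sgn_bounded_op a = inverse (norm a) *\<^sub>R a"
definition uniformity_bounded_op :: "('a bounded_op \<times> 'a bounded_op) filter"
  where "uniformity_bounded_op = (INF e\<in>{0<..}. principal {(x, y). dist x y < e})"
definition open_bounded_op :: "'a bounded_op set \<Rightarrow> bool"
  where "open_bounded_op U = (\<forall>x\<in>U. \<forall>\<^sub>F (x', y) in uniformity. x' = x \<longrightarrow> y \<in> U)"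

instance
proof
  fix a b c :: "'a bounded_op" and r s :: real
  show "a + b + c = a + (b + c)" by transfer (simp add: add.assoc)
  show "a + b = b + a" by transfer (simp add: add.commute)
  show "0 + a = a" by transfer simp
  show "- a + a = 0" by transfer simp
  show "a - b = a + - b" by transfer simp
  show "r *\<^sub>R (a + b) = r *\<^sub>R a + r *\<^sub>R b" by transfer (rule scaleR_add_right)
  show "(r + s) *\<^sub>R a = r *\<^sub>R a + s *\<^sub>R a" by transfer (rule scaleR_add_left)
  show "r *\<^sub>R s *\<^sub>R a = (r * s) *\<^sub>R a" by transfer simp
  show "1 *\<^sub>R a = a" by transfer simp
  show "r *\<^sub>R a = complex_of_real r *\<^sub>C a"
    by transfer (rule blinfun_eqI, subst bounded_linear_Blinfun_apply,
      auto intro: bounded_linear_compose[OF bounded_linear_scaleC] blinfun.bounded_linear_right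
       simp: blinfun.scaleR_left scaleR_scaleC)
  show "dist a b = norm (a - b)" by (rule dist_bounded_op_def)
  show "sgn a = inverse (norm a) *\<^sub>R a" by (rule sgn_bounded_op_def)
  show "(uniformity :: ('a bounded_op \<times> 'a bounded_op) filter)
      = (INF e\<in>{0<..}. principal {(x, y). dist x y < e})"
    by (rule uniformity_bounded_op_def)
  show "open U = (\<forall>x\<in>U. \<forall>\<^sub>F (x', y) in uniformity. x' = x \<longrightarrow> y \<in> U)" for U :: "'a bounded_op set"
    by (rule open_bounded_op_def)
  show "(norm a = 0) = (a = 0)" by transfer simp
  show "norm (a + b) \<le> norm a + norm b" by transfer (rule norm_triangle_ineq)
  show "norm (r *\<^sub>R a) = \<bar>r\<bar> * norm a" by transfer simp
  show "norm (a * b) \<le> norm a * norm b" by transfer (rule norm_blinfun_compose)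
  show "a * b * c = a * (b * c)" by transfer (rule blinfun_eqI, simp)
  show "(a + b) * c = a * c + b * c" by transfer (rule blinfun_eqI, simp add: blinfun.add_left)
  show "a * (b + c) = a * b + a * c"
    by transfer (rule blinfun_eqI, simp add: blinfun.add_left blinfun.add_right)
  show "1 * a = a" by transfer (rule blinfun_eqI, simp)
  show "a * 1 = a" by transfer (rule blinfun_eqI, simp)
  show "r *\<^sub>R a * b = r *\<^sub>R (a * b)" by transfer (rule blinfun_eqI, simp add: blinfun.scaleR_left)
  show "a * r *\<^sub>R b = r *\<^sub>R (a * b)"
    by transfer (rule blinfun_eqI, simp add: blinfun.scaleR_left blinfun.scaleR_right)
qed

end

lemma bounded_op_eqI: "(\<And>\<xi>. op_apply a \<xi> = op_apply b \<xi>) \<Longrightarrow> a = b"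
  by transfer (rule blinfun_eqI)

lemma op_apply_simps [simp]:
  "op_apply 0 \<xi> = 0" "op_apply 1 \<xi> = \<xi>"
  "op_apply (a + b) \<xi> = op_apply a \<xi> + op_apply b \<xi>"
  "op_apply (a - b) \<xi> = op_apply a \<xi> - op_apply b \<xi>"
  "op_apply (- a) \<xi> = - op_apply a \<xi>"
  "op_apply (a * b) \<xi> = op_apply a (op_apply b \<xi>)"
  "op_apply (r *\<^sub>R a) \<xi> = r *\<^sub>R op_apply a \<xi>"
  by (transfer; simp add: blinfun.bilinear_simps)+

lemma op_apply_scaleC [simp]: "op_apply (c *\<^sub>C a) \<xi> = c *\<^sub>C op_apply a \<xi>"
  by transfer (subst bounded_linear_Blinfun_apply,
    auto intro: bounded_linear_compose[OF bounded_linear_scaleC] blinfun.bounded_linear_right)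

lemma bounded_linear_op_apply: "bounded_linear (op_apply a)"
  by transfer (rule blinfun.bounded_linear_right)

lemma norm_op_apply: "norm (op_apply a \<xi>) \<le> norm a * norm \<xi>"
  by transfer (rule norm_blinfun)

lemma op_apply_scaleC_right: "op_apply a (c *\<^sub>C \<xi>) = c *\<^sub>C op_apply a \<xi>"
  by transfer blast

lemma norm_op_scaleC: "norm (c *\<^sub>C (a :: 'h::complex_hilbert bounded_op)) \<le> cmod c * norm a"
proof -
  have *: "norm a \<le> K" if "0 \<le> K" "\<And>\<xi>. norm (op_apply a \<xi>) \<le> K * norm \<xi>"
    for a :: "'h bounded_op" and K
    using that by transfer (rule norm_blinfun_bound)
  show ?thesis
    by (rule *) (auto simp: norm_scaleC mult.assoc intro: mult_left_mono norm_op_apply)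
qed

text \<open>The adjoint is unique, and exists by the Riesz representation theorem.\<close>

definition adj :: "'h::complex_hilbert bounded_op \<Rightarrow> 'h bounded_op" where
  "adj a = (THE b. \<forall>\<xi> \<eta>. cinner (op_apply b \<xi>) \<eta> = cinner \<xi> (op_apply a \<eta>))"

definition self_adjoint :: "'h::complex_hilbert bounded_op \<Rightarrow> bool" where
  "self_adjoint a \<longleftrightarrow> adj a = a"

text \<open>The defining series of the constant \<open>exp\<close>, whose type class would exclude \<open>H = 0\<close>.\<close>

definition op_exp :: "'h::complex_hilbert bounded_op \<Rightarrow> 'h bounded_op" where
  "op_exp a = (\<Sum>n. a ^ n /\<^sub>R fact n)"

text \<open>The spectrum is a subset of the complex plane; for self-adjoint operators it lies on the real
  axis, where the metric is the usual one, so its diameter is that of a set of reals.\<close>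

definition spectrum :: "'h::complex_hilbert bounded_op \<Rightarrow> complex set" where
  "spectrum a = {z. \<not> (\<exists>b. (a - z *\<^sub>C 1) * b = 1 \<and> b * (a - z *\<^sub>C 1) = 1)}"

definition commutant :: "'h::complex_hilbert bounded_op set \<Rightarrow> 'h bounded_op set" where
  "commutant S = {x. \<forall>y\<in>S. x * y = y * x}"

definition von_neumann_algebra :: "'h::complex_hilbert bounded_op set \<Rightarrow> bool" where
  "von_neumann_algebra M \<longleftrightarrow> (\<forall>x\<in>M. adj x \<in> M) \<and> commutant (commutant M) = M"

definition vN_generated :: "'h::complex_hilbert bounded_op set \<Rightarrow> 'h bounded_op set" where
  "vN_generated S = \<Inter>{M. von_neumann_algebra M \<and> S \<subseteq> M}"

section \<open>Maps on B(H)\<close>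

text \<open>An \<open>n \<times> n\<close> matrix over \<open>B(H)\<close> is a function of two indices below \<open>n\<close>. It acts on the
  \<open>n\<close>-fold Hilbert sum of \<open>H\<close>, and \<open>mat_norm n\<close> is its operator norm there.\<close>

definition mat_norm :: "nat \<Rightarrow> (nat \<Rightarrow> nat \<Rightarrow> 'h::complex_hilbert bounded_op) \<Rightarrow> real" where
  "mat_norm n X =
    (SUP \<xi>\<in>{\<xi>. L2_set (\<lambda>j. norm (\<xi> j)) {..<n} \<le> 1}.
      L2_set (\<lambda>i. norm (\<Sum>j<n. op_apply (X i j) (\<xi> j))) {..<n})"

lemma mat_norm_bdd:
  "bdd_above ((\<lambda>\<xi>. L2_set (\<lambda>i. norm (\<Sum>j<n. op_apply (X i j) (\<xi> j))) {..<n})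
     ` {\<xi>::nat \<Rightarrow> 'h::complex_hilbert. L2_set (\<lambda>j. norm (\<xi> j)) {..<n} \<le> 1})"
proof (rule bdd_aboveI2)
  fix \<xi> :: "nat \<Rightarrow> 'h" assume "\<xi> \<in> {\<xi>. L2_set (\<lambda>j. norm (\<xi> j)) {..<n} \<le> 1}"
  then have *: "norm (\<xi> j) \<le> 1" if "j < n" for j
    using member_le_L2_set[of "{..<n}" j "\<lambda>j. norm (\<xi> j)"] that by simp
  have "L2_set (\<lambda>i. norm (\<Sum>j<n. op_apply (X i j) (\<xi> j))) {..<n}
      \<le> (\<Sum>i<n. norm (\<Sum>j<n. op_apply (X i j) (\<xi> j)))"
    by (rule L2_set_le_sum) simp
  also have "\<dots> \<le> (\<Sum>i<n. \<Sum>j<n. norm (X i j))"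
  proof (intro sum_mono order_trans[OF norm_sum])
    fix i j assume "j \<in> {..<n}"
    then have "norm (X i j) * norm (\<xi> j) \<le> norm (X i j) * 1" by (intro mult_left_mono *) auto
    then show "norm (op_apply (X i j) (\<xi> j)) \<le> norm (X i j)"
      using norm_op_apply[of "X i j" "\<xi> j"] by simp
  qed
  finally show "L2_set (\<lambda>i. norm (\<Sum>j<n. op_apply (X i j) (\<xi> j))) {..<n}
      \<le> (\<Sum>i<n. \<Sum>j<n. norm (X i j))" .
qed

lemma mat_norm_le:
  fixes X :: "nat \<Rightarrow> nat \<Rightarrow> 'h::complex_hilbert bounded_op"
  assumes "\<And>\<xi>. L2_set (\<lambda>j. norm (\<xi> j)) {..<n} \<le> 1 \<Longrightarrow>
    L2_set (\<lambda>i. norm (\<Sum>j<n. op_apply (X i j) (\<xi> j))) {..<n} \<le> K"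
  shows "mat_norm n X \<le> K"
  unfolding mat_norm_def
proof (rule cSUP_least)
  have "L2_set (\<lambda>j::nat. norm (0::'h)) {..<n} \<le> 1" by (simp add: L2_set_def)
  then show "{\<xi>::nat \<Rightarrow> 'h. L2_set (\<lambda>j. norm (\<xi> j)) {..<n} \<le> 1} \<noteq> {}"
    using CollectI[of "\<lambda>\<xi>. L2_set (\<lambda>j. norm (\<xi> j)) {..<n} \<le> 1" "\<lambda>_. 0 :: 'h"]
    by (metis empty_iff)
  show "L2_set (\<lambda>i. norm (\<Sum>j<n. op_apply (X i j) (\<xi> j))) {..<n} \<le> K"
    if "\<xi> \<in> {\<xi>. L2_set (\<lambda>j. norm (\<xi> j)) {..<n} \<le> 1}" for \<xi>
    by (rule assms) (rule CollectD[OF that])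
qed

lemma L2_set_scaleR: "0 \<le> r \<Longrightarrow> L2_set (\<lambda>i. norm (r *\<^sub>R f i)) A = r * L2_set (\<lambda>i. norm (f i)) A"
  by (subst L2_set_right_distrib) auto

lemma mat_norm_apply:
  "L2_set (\<lambda>i. norm (\<Sum>j<n. op_apply (X i j) (\<xi> j))) {..<n}
    \<le> mat_norm n X * L2_set (\<lambda>j. norm (\<xi> j)) {..<n}"
proof -
  define r where "r = L2_set (\<lambda>j. norm (\<xi> j)) {..<n}"
  define \<zeta> where "\<zeta> = (\<lambda>j. inverse r *\<^sub>R \<xi> j)"
  have r: "0 \<le> r" unfolding r_def by (rule L2_set_nonneg)
  have lin: "linear (op_apply a)" for a :: "'a bounded_op"
    using bounded_linear.linear bounded_linear_op_apply .
  have \<xi>: "\<xi> j = r *\<^sub>R \<zeta> j" if "j < n" for j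
  proof (cases "r = 0")
    case True
    then have "norm (\<xi> j) \<le> 0"
      using member_le_L2_set[of "{..<n}" j "\<lambda>j. norm (\<xi> j)"] that unfolding r_def by auto
    then show ?thesis using True by simp
  qed (simp add: \<zeta>_def)
  have "L2_set (\<lambda>j. norm (\<zeta> j)) {..<n} = inverse r * r"
    unfolding \<zeta>_def using r by (subst L2_set_scaleR) (auto simp: r_def)
  then have 1: "L2_set (\<lambda>j. norm (\<zeta> j)) {..<n} \<le> 1" by (cases "r = 0") auto
  have "L2_set (\<lambda>i. norm (\<Sum>j<n. op_apply (X i j) (\<xi> j))) {..<n}
      = L2_set (\<lambda>i. norm (r *\<^sub>R (\<Sum>j<n. op_apply (X i j) (\<zeta> j)))) {..<n}"
  proof (rule L2_set_cong[OF refl])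
    fix i
    have "(\<Sum>j<n. op_apply (X i j) (\<xi> j)) = (\<Sum>j<n. r *\<^sub>R op_apply (X i j) (\<zeta> j))"
      by (rule sum.cong[OF refl]) (simp only: lessThan_iff \<xi> linear_scale[OF lin])
    then show "norm (\<Sum>j<n. op_apply (X i j) (\<xi> j)) = norm (r *\<^sub>R (\<Sum>j<n. op_apply (X i j) (\<zeta> j)))"
      by (simp only: scaleR_sum_right)
  qed
  also have "\<dots> = r * L2_set (\<lambda>i. norm (\<Sum>j<n. op_apply (X i j) (\<zeta> j))) {..<n}"
    by (rule L2_set_scaleR[OF r])
  also have "\<dots> \<le> r * mat_norm n X"
    using 1 unfolding mat_norm_def by (intro mult_left_mono[OF _ r] cSUP_upper mat_norm_bdd) simp
  finally show ?thesis unfolding r_def by (simp only: mult.commute)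
qed

lemma mat_norm_nonneg: "0 \<le> mat_norm n X"
proof -
  have "L2_set (\<lambda>i. norm (\<Sum>j<n. op_apply (X i j) ((\<lambda>_. 0) j))) {..<n} \<le> mat_norm n X"
    unfolding mat_norm_def by (intro cSUP_upper mat_norm_bdd) (simp add: L2_set_def)
  then show ?thesis using L2_set_nonneg order_trans by blast
qed

lemma mat_norm_mult:
  "mat_norm n (\<lambda>i j. u * X i j * v) \<le> norm u * mat_norm n X * norm v"
proof (rule mat_norm_le)
  fix \<xi> :: "nat \<Rightarrow> 'a" assume 1: "L2_set (\<lambda>j. norm (\<xi> j)) {..<n} \<le> 1"
  have "L2_set (\<lambda>i. norm (\<Sum>j<n. op_apply (u * X i j * v) (\<xi> j))) {..<n}
      = L2_set (\<lambda>i. norm (op_apply u (\<Sum>j<n. op_apply (X i j) (op_apply v (\<xi> j))))) {..<n}"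
    by (simp only: op_apply_simps linear_sum[OF bounded_linear.linear[OF bounded_linear_op_apply]])
  also have "\<dots> \<le> L2_set (\<lambda>i. norm u * norm (\<Sum>j<n. op_apply (X i j) (op_apply v (\<xi> j)))) {..<n}"
    by (rule L2_set_mono) (auto intro: norm_op_apply)
  also have "\<dots> = norm u * L2_set (\<lambda>i. norm (\<Sum>j<n. op_apply (X i j) (op_apply v (\<xi> j)))) {..<n}"
    by (rule L2_set_right_distrib[symmetric]) simp
  also have "\<dots> \<le> norm u * (mat_norm n X * L2_set (\<lambda>j. norm (op_apply v (\<xi> j))) {..<n})"
    by (intro mult_left_mono mat_norm_apply) simp
  also have "\<dots> \<le> norm u * (mat_norm n X * (norm v * 1))"
  proof (intro mult_left_mono mat_norm_nonneg)
    have "L2_set (\<lambda>j. norm (op_apply v (\<xi> j))) {..<n} \<le> L2_set (\<lambda>j. norm v * norm (\<xi> j)) {..<n}"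
      by (rule L2_set_mono) (auto intro: norm_op_apply)
    also have "\<dots> = norm v * L2_set (\<lambda>j. norm (\<xi> j)) {..<n}" by (rule L2_set_right_distrib[symmetric]) simp
    also have "\<dots> \<le> norm v * 1" using 1 by (intro mult_left_mono) auto
    finally show "L2_set (\<lambda>j. norm (op_apply v (\<xi> j))) {..<n} \<le> norm v * 1" .
  qed simp
  finally show "L2_set (\<lambda>i. norm (\<Sum>j<n. op_apply (u * X i j * v) (\<xi> j))) {..<n}
      \<le> norm u * mat_norm n X * norm v" by (simp add: mult.assoc)
qed

lemma mat_norm_diff: "mat_norm n (\<lambda>i j. X i j - Y i j) \<le> mat_norm n X + mat_norm n Y"
proof (rule mat_norm_le)
  fix \<xi> :: "nat \<Rightarrow> 'a" assume 1: "L2_set (\<lambda>j. norm (\<xi> j)) {..<n} \<le> 1"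
  have *: "L2_set (\<lambda>i. norm (\<Sum>j<n. op_apply (Z i j) (\<xi> j))) {..<n} \<le> mat_norm n Z" for Z
    unfolding mat_norm_def by (intro cSUP_upper mat_norm_bdd) (simp add: 1)
  have "L2_set (\<lambda>i. norm (\<Sum>j<n. op_apply (X i j - Y i j) (\<xi> j))) {..<n}
      \<le> L2_set (\<lambda>i. norm (\<Sum>j<n. op_apply (X i j) (\<xi> j)) + norm (\<Sum>j<n. op_apply (Y i j) (\<xi> j))) {..<n}"
    by (rule L2_set_mono) (auto simp: sum_subtractf intro: norm_triangle_ineq4)
  also have "\<dots> \<le> mat_norm n X + mat_norm n Y"
    by (intro order_trans[OF L2_set_triangle_ineq] add_mono *)
  finally show "L2_set (\<lambda>i. norm (\<Sum>j<n. op_apply (X i j - Y i j) (\<xi> j))) {..<n}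
      \<le> mat_norm n X + mat_norm n Y" .
qed

definition mat_positive :: "nat \<Rightarrow> (nat \<Rightarrow> nat \<Rightarrow> 'h::complex_hilbert bounded_op) \<Rightarrow> bool" where
  "mat_positive n X \<longleftrightarrow>
    (\<forall>\<xi>. (\<Sum>i<n. \<Sum>j<n. cinner (\<xi> i) (op_apply (X i j) (\<xi> j))) \<in> \<real> \<and>
         0 \<le> Re (\<Sum>i<n. \<Sum>j<n. cinner (\<xi> i) (op_apply (X i j) (\<xi> j))))"

definition amplification_norms :: "('h::complex_hilbert bounded_op \<Rightarrow> 'h bounded_op) \<Rightarrow> real set" where
  "amplification_norms T = {mat_norm n (\<lambda>i j. T (X i j)) | n X. mat_norm n X \<le> 1}"

definition completely_bounded :: "('h::complex_hilbert bounded_op \<Rightarrow> 'h bounded_op) \<Rightarrow> bool" where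
  "completely_bounded T \<longleftrightarrow> bdd_above (amplification_norms T)"

text \<open>As a real number this is meaningful for completely bounded maps only. All maps to which it is
  applied below are; see \<open>completely_bounded_flow_diff\<close> and \<open>completely_bounded_deriv_commutator\<close>.\<close>

definition cb_norm :: "('h::complex_hilbert bounded_op \<Rightarrow> 'h bounded_op) \<Rightarrow> real" where
  "cb_norm T = Sup (amplification_norms T)"

lemma cb_norm_le:
  assumes "\<And>n X. mat_norm n X \<le> 1 \<Longrightarrow> mat_norm n (\<lambda>i j. T (X i j)) \<le> K"
  shows "completely_bounded T" and "cb_norm T \<le> K"
proof -
  show "completely_bounded T"
    unfolding completely_bounded_def
    by (rule bdd_aboveI[of _ K]) (auto simp: amplification_norms_def assms)
  have "mat_norm 0 (\<lambda>_ _. 0 :: 'a bounded_op) \<le> 1" by (rule mat_norm_le) (simp add: L2_set_def)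
  then have "amplification_norms T \<noteq> {}" unfolding amplification_norms_def by blast
  then show "cb_norm T \<le> K"
    unfolding cb_norm_def by (rule cSup_least) (auto simp: amplification_norms_def assms)
qed

lemma mat_norm_le_cb_norm:
  assumes "completely_bounded T" "mat_norm n X \<le> 1"
  shows "mat_norm n (\<lambda>i j. T (X i j)) \<le> cb_norm T"
  using assms unfolding completely_bounded_def cb_norm_def
  by (intro cSup_upper) (auto simp: amplification_norms_def)

lemma completely_bounded_id: "completely_bounded (\<lambda>x. x)" "cb_norm (\<lambda>x. x) \<le> 1"
  using cb_norm_le[of "\<lambda>x. x" 1] by auto

lemma completely_bounded_mult:
  assumes "completely_bounded T"
  shows "completely_bounded (\<lambda>x. u * T x * v)" "cb_norm (\<lambda>x. u * T x * v) \<le> norm u * cb_norm T * norm v"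
proof -
  have "mat_norm n (\<lambda>i j. u * T (X i j) * v) \<le> norm u * cb_norm T * norm v"
    if "mat_norm n X \<le> 1" for n X
    using order_trans[OF mat_norm_mult, of u n "\<lambda>i j. T (X i j)" v "norm u * cb_norm T * norm v"]
      mat_norm_le_cb_norm[OF assms that] by (simp add: mult_left_mono mult_right_mono)
  then show "completely_bounded (\<lambda>x. u * T x * v)"
    and "cb_norm (\<lambda>x. u * T x * v) \<le> norm u * cb_norm T * norm v"
    using cb_norm_le[where T = "\<lambda>x. u * T x * v" and K = "norm u * cb_norm T * norm v"] by blast+
qed

lemma completely_bounded_diff:
  assumes "completely_bounded S" "completely_bounded T"
  shows "completely_bounded (\<lambda>x. S x - T x)" "cb_norm (\<lambda>x. S x - T x) \<le> cb_norm S + cb_norm T"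
proof -
  have "mat_norm n (\<lambda>i j. S (X i j) - T (X i j)) \<le> cb_norm S + cb_norm T" if "mat_norm n X \<le> 1" for n X
    using mat_norm_diff[of n "\<lambda>i j. S (X i j)" "\<lambda>i j. T (X i j)"]
      mat_norm_le_cb_norm[OF assms(1) that] mat_norm_le_cb_norm[OF assms(2) that] by linarith
  then show "completely_bounded (\<lambda>x. S x - T x)"
    and "cb_norm (\<lambda>x. S x - T x) \<le> cb_norm S + cb_norm T"
    using cb_norm_le[where T = "\<lambda>x. S x - T x" and K = "cb_norm S + cb_norm T"] by blast+
qed

definition op_clinear :: "('h::complex_hilbert bounded_op \<Rightarrow> 'h bounded_op) \<Rightarrow> bool" where
  "op_clinear T \<longleftrightarrow> (\<forall>x y. T (x + y) = T x + T y) \<and> (\<forall>c x. T (c *\<^sub>C x) = c *\<^sub>C T x)"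

definition completely_positive :: "('h::complex_hilbert bounded_op \<Rightarrow> 'h bounded_op) \<Rightarrow> bool" where
  "completely_positive T \<longleftrightarrow>
    op_clinear T \<and> (\<forall>n X. mat_positive n X \<longrightarrow> mat_positive n (\<lambda>i j. T (X i j)))"

text \<open>The ultraweak topology is the initial topology of the functionals
  \<open>x \<mapsto> \<Sum>k. \<langle>\<xi> k, x (\<eta> k)\<rangle>\<close> with \<open>\<xi>\<close> and \<open>\<eta>\<close> square-summable; normal means ultraweakly continuous.\<close>

definition ultraweak_topology :: "'h::complex_hilbert bounded_op topology" where
  "ultraweak_topology = topology_generated_by
    {{x. (\<Sum>k. cinner (\<xi> k) (op_apply x (\<eta> k))) \<in> U} | \<xi> \<eta> U.
      summable (\<lambda>k. (norm (\<xi> k))\<^sup>2) \<and> summable (\<lambda>k. (norm (\<eta> k))\<^sup>2) \<and> open U}"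

definition normal_map :: "('h::complex_hilbert bounded_op \<Rightarrow> 'h bounded_op) \<Rightarrow> bool" where
  "normal_map T \<longleftrightarrow> continuous_map ultraweak_topology ultraweak_topology T"

definition Ad :: "'h::complex_hilbert bounded_op \<Rightarrow> 'h bounded_op \<Rightarrow> 'h bounded_op" where
  "Ad u x = adj u * x * u"

definition flow :: "'h::complex_hilbert bounded_op \<Rightarrow> real \<Rightarrow> 'h bounded_op \<Rightarrow> 'h bounded_op" where
  "flow a s = Ad (op_exp ((\<i> * complex_of_real s) *\<^sub>C a))"

definition inner_deriv :: "'h::complex_hilbert bounded_op \<Rightarrow> 'h bounded_op \<Rightarrow> 'h bounded_op" where
  "inner_deriv a x = (- \<i>) *\<^sub>C (a * x - x * a)"

definition deriv_commutator ::
    "'h::complex_hilbert bounded_op \<Rightarrow> 'h bounded_op \<Rightarrow> 'h bounded_op \<Rightarrow> 'h bounded_op" where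
  "deriv_commutator a b x = inner_deriv a (inner_deriv b x) - inner_deriv b (inner_deriv a x)"

definition commutator_defect ::
    "'h::complex_hilbert bounded_op \<Rightarrow> 'h bounded_op \<Rightarrow> real \<Rightarrow> real \<Rightarrow> real" where
  "commutator_defect a b s t =
    cb_norm (\<lambda>x. flow a s (flow b t x) - flow b t (flow a s x))"

lemma completely_bounded_flow: "completely_bounded T \<Longrightarrow> completely_bounded (\<lambda>x. flow a s (T x))"
  unfolding flow_def Ad_def by (rule completely_bounded_mult)

lemma completely_bounded_flow_diff:
  "completely_bounded (\<lambda>x. flow a s (flow b t x) - flow b t (flow a s x))"
  "completely_bounded (\<lambda>x. flow a s x - x)"
  by (intro completely_bounded_diff completely_bounded_flow completely_bounded_id)+

lemma inner_deriv_eq: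
  "inner_deriv a x = ((- \<i>) *\<^sub>C a) * x * 1 - 1 * x * ((- \<i>) *\<^sub>C a)"
  unfolding inner_deriv_def
  by (rule bounded_op_eqI) (simp add: scaleC_diff_right op_apply_scaleC_right)

lemma completely_bounded_inner_deriv:
  assumes "completely_bounded T"
  shows "completely_bounded (\<lambda>x. inner_deriv a (T x))"
    and "cb_norm (\<lambda>x. inner_deriv a (T x)) \<le> 2 * norm a * cb_norm T"
proof -
  have n1: "norm (1 :: 'a bounded_op) \<le> 1" by transfer (rule norm_blinfun_id_le)
  have c: "0 \<le> cb_norm T"
    using mat_norm_le_cb_norm[OF assms, of 0 "\<lambda>_ _. 0"] mat_norm_nonneg[of 0 "\<lambda>_ _. T 0"]
    by (simp add: mat_norm_le L2_set_def)
  have na: "norm ((- \<i>) *\<^sub>C a) \<le> norm a" by (rule order_trans[OF norm_op_scaleC]) simp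
  note d = completely_bounded_diff[OF completely_bounded_mult(1)[OF assms, of "(- \<i>) *\<^sub>C a" 1]
    completely_bounded_mult(1)[OF assms, of 1 "(- \<i>) *\<^sub>C a"]]
  show "completely_bounded (\<lambda>x. inner_deriv a (T x))" unfolding inner_deriv_eq by (rule d)
  have "norm ((- \<i>) *\<^sub>C a) * cb_norm T * norm (1 :: 'a bounded_op) \<le> norm a * cb_norm T * 1"
    using c n1 na by (intro mult_mono) auto
  moreover have "norm (1 :: 'a bounded_op) * cb_norm T * norm ((- \<i>) *\<^sub>C a) \<le> 1 * cb_norm T * norm a"
    using c n1 na by (intro mult_mono) auto
  moreover have "2 * norm a * cb_norm T = norm a * cb_norm T * 1 + 1 * cb_norm T * norm a" by simp
  ultimately show "cb_norm (\<lambda>x. inner_deriv a (T x)) \<le> 2 * norm a * cb_norm T"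
    using d(2) completely_bounded_mult(2)[OF assms, of "(- \<i>) *\<^sub>C a" 1]
      completely_bounded_mult(2)[OF assms, of 1 "(- \<i>) *\<^sub>C a"]
    unfolding inner_deriv_eq by linarith
qed

lemma completely_bounded_deriv_commutator:
  "completely_bounded (deriv_commutator a b)"
  "cb_norm (deriv_commutator a b) \<le> 8 * norm a * norm b"
proof -
  have *: "completely_bounded (\<lambda>x. inner_deriv a (inner_deriv b x))"
    "cb_norm (\<lambda>x. inner_deriv a (inner_deriv b x)) \<le> 4 * norm a * norm b"
    for a b :: "'a bounded_op"
  proof -
    note b = completely_bounded_inner_deriv[OF completely_bounded_id(1), of b]
    note ab = completely_bounded_inner_deriv[OF b(1), of a]
    show "completely_bounded (\<lambda>x. inner_deriv a (inner_deriv b x))" by (rule ab)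
    have "cb_norm (inner_deriv b) \<le> 2 * norm b * 1"
      by (rule order_trans[OF b(2)]) (intro mult_left_mono completely_bounded_id(2), simp)
    then have "2 * norm a * cb_norm (inner_deriv b) \<le> 2 * norm a * (2 * norm b * 1)"
      by (intro mult_left_mono) auto
    then show "cb_norm (\<lambda>x. inner_deriv a (inner_deriv b x)) \<le> 4 * norm a * norm b"
      using ab(2) by (simp add: mult_ac)
  qed
  have e: "deriv_commutator a b = (\<lambda>x. inner_deriv a (inner_deriv b x) - inner_deriv b (inner_deriv a x))"
    by (rule ext) (rule deriv_commutator_def)
  note d = completely_bounded_diff[OF *(1)[of a b] *(1)[of b a]]
  show "completely_bounded (deriv_commutator a b)" unfolding e by (rule d)
  show "cb_norm (deriv_commutator a b) \<le> 8 * norm a * norm b"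
    using d(2) *(2)[of a b] *(2)[of b a] unfolding e by (simp add: mult_ac)
qed

definition sa_ball :: "'h::complex_hilbert bounded_op set \<Rightarrow> 'h bounded_op set" where
  "sa_ball M = {a\<in>M. self_adjoint a \<and> norm a \<le> 1}"

definition Gamma_vN :: "'h::complex_hilbert bounded_op set \<Rightarrow> 'h bounded_op set \<Rightarrow> real" where
  "Gamma_vN M N = (SUP (a, b)\<in>sa_ball M \<times> sa_ball N. cb_norm (deriv_commutator a b))"

lemma bdd_above_Gamma_vN:
  "bdd_above ((\<lambda>(a, b). cb_norm (deriv_commutator a b)) ` (sa_ball M \<times> sa_ball N))"
proof (rule bdd_aboveI2)
  fix p assume "p \<in> sa_ball M \<times> sa_ball N"
  then obtain a b where p: "p = (a, b)" "norm a \<le> 1" "norm b \<le> 1" by (auto simp: sa_ball_def)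
  have "8 * norm a * norm b \<le> 8 * 1 * 1" using p by (intro mult_mono) auto
  then show "(case p of (a, b) \<Rightarrow> cb_norm (deriv_commutator a b)) \<le> 8"
    using completely_bounded_deriv_commutator(2)[of a b] p by simp
qed

section \<open>Nets over Minkowski space\<close>

text \<open>A point is a pair of a time and a space coordinate; the number \<open>CARD('d)\<close> of space dimensions
  is arbitrary.\<close>

type_synonym 'd minkowski = "real \<times> (real ^ 'd)"

definition chronological :: "'d::finite minkowski \<Rightarrow> 'd minkowski \<Rightarrow> bool" where
  "chronological x y \<longleftrightarrow> norm (snd y - snd x) < fst y - fst x"

definition spacelike :: "'d::finite minkowski \<Rightarrow> 'd minkowski \<Rightarrow> bool" where
  "spacelike x y \<longleftrightarrow> \<bar>fst y - fst x\<bar> < norm (snd y - snd x)"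

definition double_cone :: "'d::finite minkowski set \<Rightarrow> bool" where
  "double_cone O1 \<longleftrightarrow>
    (\<exists>p q. chronological p q \<and> O1 = {x. chronological p x \<and> chronological x q})"

text \<open>The interior makes the causal complement an open region. For open sets, being contained in it
  is the same as being pointwise spacelike to \<open>R\<close>.\<close>

definition causal_complement :: "'d::finite minkowski set \<Rightarrow> 'd minkowski set" where
  "causal_complement R = interior {x. \<forall>y\<in>R. spacelike x y}"

definition spacelike_pair :: "'d::finite minkowski set \<Rightarrow> 'd minkowski set \<Rightarrow> bool" where
  "spacelike_pair O1 O2 \<longleftrightarrow> double_cone O1 \<and> double_cone O2 \<and> O1 \<subseteq> causal_complement O2"

text \<open>Only the values of a net at double cones matter.\<close>

definition haag_kastler_net :: "('d::finite minkowski set \<Rightarrow> 'h::complex_hilbert bounded_op set) \<Rightarrow> bool" where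
  "haag_kastler_net A \<longleftrightarrow>
    (\<forall>O1. double_cone O1 \<longrightarrow> von_neumann_algebra (A O1)) \<and>
    (\<forall>O1 O2. double_cone O1 \<longrightarrow> double_cone O2 \<longrightarrow> O1 \<subseteq> O2 \<longrightarrow> A O1 \<subseteq> A O2) \<and>
    (\<forall>O1 O2. spacelike_pair O1 O2 \<longrightarrow> (\<forall>x\<in>A O1. \<forall>y\<in>A O2. x * y = y * x))"

definition region_algebra ::
    "('d::finite minkowski set \<Rightarrow> 'h::complex_hilbert bounded_op set) \<Rightarrow> 'd minkowski set \<Rightarrow> 'h bounded_op set" where
  "region_algebra A R = vN_generated (\<Union>{A V | V. double_cone V \<and> V \<subseteq> R})"

definition dual_net ::
    "('d::finite minkowski set \<Rightarrow> 'h::complex_hilbert bounded_op set) \<Rightarrow> 'd minkowski set \<Rightarrow> 'h bounded_op set" where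
  "dual_net A O1 = commutant (region_algebra A (causal_complement O1))"

definition essential_duality :: "('d::finite minkowski set \<Rightarrow> 'h::complex_hilbert bounded_op set) \<Rightarrow> bool" where
  "essential_duality A \<longleftrightarrow>
    (\<forall>O1 O2. spacelike_pair O1 O2 \<longrightarrow> (\<forall>x\<in>dual_net A O1. \<forall>y\<in>dual_net A O2. x * y = y * x))"

definition Gamma_net ::
    "('d::finite minkowski set \<Rightarrow> 'h::complex_hilbert bounded_op set) \<Rightarrow> 'd minkowski set \<Rightarrow> 'd minkowski set \<Rightarrow> real" where
  "Gamma_net A O1 O2 = Gamma_vN (dual_net A O1) (dual_net A O2)"

text \<open>The normal unital completely positive maps on \<open>B(H)\<close> fixing the algebra of the causal complement.\<close>

definition NS ::
    "('d::finite minkowski set \<Rightarrow> 'h::complex_hilbert bounded_op set) \<Rightarrow> 'd minkowski set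
      \<Rightarrow> ('h bounded_op \<Rightarrow> 'h bounded_op) set" where
  "NS A O1 = {T. normal_map T \<and> T 1 = 1 \<and> completely_positive T \<and>
                 (\<forall>x\<in>region_algebra A (causal_complement O1). T x = x)}"

end

theory Submission
  imports Defs
begin

text \<open>
  The commutator of two inner derivations is again inner: \<open>[D\<^sub>a, D\<^sub>b] = D\<^sub>c\<close> with \<open>c = -i[a, b]\<close>.
  The cb norm of \<open>D\<^sub>c\<close> for self-adjoint \<open>c\<close> is at most twice the distance of \<open>c\<close> to the midpoint of
  its numerical range, that is \<open>diam \<sigma>(c)\<close>, and rank-one operators between approximate
  eigenvectors at the two ends of the numerical range attain this bound. A second-order expansion of
  the exponentials, uniform on norm-bounded sets, writes the commutator of the flows as
  \<open>s t D\<^sub>c\<close> plus a sum of elementary maps \<open>x \<mapsto> u x v\<close> of cb norm \<open>O(|st| (|s| + |t|))\<close>. A scalar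
  commutator \<open>[a, b]\<close> with \<open>a\<close> self-adjoint vanishes, so \<open>diam \<sigma>(c) = 0\<close> exactly if \<open>a\<close> and \<open>b\<close>
  commute; since the dual net consists of \<open>*\<close>-closed linear spaces, self-adjoint contractions
  detect essential duality.
\<close>

section \<open>The inner product, the Riesz representation and adjoints\<close>

text \<open>The limit in (i) leaves the ratio of \<open>s\<close> and \<open>t\<close> free, so an
  error of third order in \<open>\<bar>s\<bar> + \<bar>t\<bar>\<close> would be useless: divided by
  \<open>\<bar>s * t\<bar>\<close> it may blow up. Every error term must carry a factor from each
  flow. This holds because only the commutator of the two exponentials enters, in which whatever
  involves one exponential alone cancels. Part (ii) moreover asks for a constant that depends only
  on a norm bound for \<open>a\<close> and \<open>b\<close>, so the estimates for the exponentials
  are uniform on balls; the suprema are then as close as the functions. The cb norm is a supremum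
  over all matrix sizes, but elementary maps bound it from above by a product of two operator norms,
  and matrices of size one suffice for the lower bound. The ends of the numerical range need not be
  eigenvalues; approximate eigenvectors there serve both the diameter of the spectrum and the norm
  of the derivation. The zero space has no unit vectors and is split off.\<close>

lemma cinner_add_left: "cinner (x + y) (z::'h::complex_hilbert) = cinner x z + cinner y z"
  by (metis cinner_add_right cinner_commute complex_cnj_add)

lemma additive_cinner_right: "Modules.additive (cinner (x::'h::complex_hilbert))"
  by (simp add: Modules.additive_def cinner_add_right)

lemma additive_cinner_left: "Modules.additive (\<lambda>x. cinner x (y::'h::complex_hilbert))"
  by (simp add: Modules.additive_def cinner_add_left)

lemmas cinner_simps =
  cinner_add_right cinner_add_left cinner_scaleC_right cinner_scaleC_left
  Modules.additive.zero[OF additive_cinner_right] additive.zero[OF additive_cinner_left]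
  Modules.additive.minus[OF additive_cinner_right] additive.minus[OF additive_cinner_left]
  Modules.additive.diff[OF additive_cinner_right] additive.diff[OF additive_cinner_left]

lemma cinner_scaleR_right: "cinner x (r *\<^sub>R (y::'h::complex_hilbert)) = complex_of_real r * cinner x y"
  by (simp add: scaleR_scaleC cinner_scaleC_right)

lemma cinner_scaleR_left: "cinner (r *\<^sub>R x) (y::'h::complex_hilbert) = complex_of_real r * cinner x y"
  by (simp add: scaleR_scaleC cinner_scaleC_left)

lemma Re_cinner_commute: "Re (cinner x y) = Re (cinner y (x::'h::complex_hilbert))"
  by (metis cinner_commute complex_cnj(1) complex.sel(1) cnj.sel(1))

lemma norm_add_square:
  "(norm (x + y))\<^sup>2 = (norm x)\<^sup>2 + 2 * Re (cinner x y) + (norm (y::'h::complex_hilbert))\<^sup>2"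
proof -
  have "complex_of_real ((norm (x + y))\<^sup>2) = cinner x x + cinner x y + cinner y x + cinner y y"
    unfolding cinner_self[symmetric] by (simp add: cinner_simps)
  then have "Re (complex_of_real ((norm (x + y))\<^sup>2)) = Re (cinner x x + cinner x y + cinner y x + cinner y y)"
    by (rule arg_cong)
  then show ?thesis using Re_cinner_commute[of x y] by (simp add: cinner_self)
qed

lemma norm_diff_square:
  "(norm (x - y))\<^sup>2 = (norm x)\<^sup>2 - 2 * Re (cinner x y) + (norm (y::'h::complex_hilbert))\<^sup>2"
  using norm_add_square[of x "- y"] by (simp add: cinner_simps)

text \<open>The triangle inequality belongs to the norm of the class, so Cauchy-Schwarz is read off
  from it by expanding both squares, reversing the usual order.\<close>

lemma Re_cinner_le: "Re (cinner x y) \<le> norm x * norm (y::'h::complex_hilbert)"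
proof -
  have "(norm (x + y))\<^sup>2 \<le> (norm x + norm y)\<^sup>2"
    by (intro power_mono norm_triangle_ineq) simp
  then show ?thesis unfolding norm_add_square by (simp add: power2_sum)
qed

lemma cmod_cinner_le: "cmod (cinner x y) \<le> norm x * norm (y::'h::complex_hilbert)"
proof (cases "cinner x y = 0")
  case False
  \<comment> \<open>The phase that rotates the inner product onto the positive real axis, where
    \<open>Re_cinner_le\<close> applies.\<close>
  define u where "u = cnj (cinner x y) / cmod (cinner x y)"
  have u: "cmod u = 1" using False by (simp add: u_def norm_divide)
  have "cinner x (u *\<^sub>C y) = cmod (cinner x y)"
    using False by (simp add: cinner_simps u_def complex_norm_square[symmetric] power2_eq_square mult.commute)
  then have "cmod (cinner x y) = Re (cinner x (u *\<^sub>C y))" by simp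
  also have "\<dots> \<le> norm x * norm y" using Re_cinner_le[of x "u *\<^sub>C y"] by (simp add: norm_scaleC u)
  finally show ?thesis .
qed simp

lemma cinner_eqI: "(\<And>z. cinner x z = cinner y z) \<Longrightarrow> x = (y::'h::complex_hilbert)"
proof -
  assume "\<And>z. cinner x z = cinner y z"
  then have "cinner (x - y) (x - y) = 0" by (simp add: cinner_simps)
  then show ?thesis by (simp add: cinner_self)
qed

text \<open>The representing vector minimises \<open>\<parallel>x\<parallel>\<^sup>2 - 2 Re (f x)\<close>; a minimising sequence is Cauchy by
  the parallelogram law.\<close>

lemma riesz_representation:
  fixes f :: "'h::complex_hilbert \<Rightarrow> complex"
  assumes add: "\<And>x y. f (x + y) = f x + f y" and scale: "\<And>c x. f (c *\<^sub>C x) = c * f x"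
    and bound: "\<And>x. cmod (f x) \<le> K * norm x"
  shows "\<exists>z. \<forall>x. f x = cinner z x"
proof -
  define F where "F x = (norm x)\<^sup>2 - 2 * Re (f x)" for x
  have scaleR: "f (r *\<^sub>R x) = r * f x" for r x by (simp add: scaleR_scaleC scale)
  have blf: "bounded_linear f"
    by (rule bounded_linear_intro[of _ K])
       (use bound in \<open>simp_all add: add scaleR scaleR_conv_of_real mult.commute\<close>)
  \<comment> \<open>Completing the square in \<open>norm x\<close>; without a lower bound the
    infimum \<open>d\<close> would be meaningless.\<close>
  have lower: "F x \<ge> - K\<^sup>2" for x
  proof -
    have "Re (f x) \<le> K * norm x" using bound[of x] complex_Re_le_cmod[of "f x"] by linarith
    moreover have "0 \<le> (norm x - K)\<^sup>2" by simp
    ultimately show ?thesis by (simp add: F_def power2_diff mult.commute)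
  qed
  have bdd: "bdd_below (range F)" by (rule bdd_belowI2) (rule lower)
  define d where "d = (INF x. F x)"
  have dle: "d \<le> F x" for x unfolding d_def by (rule cINF_lower[OF bdd]) simp
  have "\<exists>x. F x < d + e" if "e > 0" for e
    using cINF_less_iff[OF _ bdd, of "d + e"] that unfolding d_def by auto
  then have "\<exists>x. F x < d + 1 / Suc n" for n by simp
  then obtain X where X: "F (X n) < d + 1 / Suc n" for n by metis
  have par: "(norm (x - y))\<^sup>2 \<le> 2 * (F x - d) + 2 * (F y - d)" for x y
  proof -
    have "4 * F ((1/2) *\<^sub>R (x + y)) = (norm (x + y))\<^sup>2 - 4 * Re (f x + f y)"
      unfolding F_def scaleR add norm_scaleR by (simp add: power_mult_distrib power2_eq_square add_divide_distrib)
    then have "(norm (x - y))\<^sup>2 = 2 * F x + 2 * F y - 4 * F ((1/2) *\<^sub>R (x + y))"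
      by (simp add: F_def norm_add_square norm_diff_square)
    then show ?thesis using dle[of "(1/2) *\<^sub>R (x + y)"] by simp
  qed
  have "Cauchy X"
  proof (rule metric_CauchyI)
    fix e :: real assume e: "e > 0"
    then have "e\<^sup>2 / 4 > 0" by simp
    from reals_Archimedean[OF this] obtain N where N: "1 / Suc N < e\<^sup>2 / 4" by (auto simp: inverse_eq_divide)
    have "dist (X m) (X n) < e" if "m \<ge> N" "n \<ge> N" for m n
    proof -
      have s: "F (X j) - d < e\<^sup>2 / 4" if "j \<ge> N" for j
      proof -
        have "1 / real (Suc j) \<le> 1 / Suc N" using that by (intro divide_left_mono) auto
        then show ?thesis using X[of j] N by linarith
      qed
      note par[of "X m" "X n"]
      also have "2 * (F (X m) - d) + 2 * (F (X n) - d) < 2 * (e\<^sup>2 / 4) + 2 * (e\<^sup>2 / 4)"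
        using s[OF that(1)] s[OF that(2)] by (intro add_strict_mono mult_strict_left_mono) auto
      finally have "(norm (X m - X n))\<^sup>2 < e\<^sup>2" by simp
      then show ?thesis using e by (simp add: dist_norm power_less_imp_less_base)
    qed
    then show "\<exists>N. \<forall>m\<ge>N. \<forall>n\<ge>N. dist (X m) (X n) < e" by blast
  qed
  then obtain z where z: "X \<longlonglongrightarrow> z" using Cauchy_convergent convergent_def by blast
  have "(\<lambda>n. F (X n)) \<longlonglongrightarrow> F z"
    unfolding F_def by (intro tendsto_intros z bounded_linear.tendsto[OF blf])
  moreover have "(\<lambda>n. d + 1 / real (Suc n)) \<longlonglongrightarrow> d + 0"
    by (intro tendsto_intros) (use LIMSEQ_inverse_real_of_nat in \<open>simp add: inverse_eq_divide\<close>)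
  ultimately have "F z \<le> d"
    using X by (intro LIMSEQ_le[of "\<lambda>n. F (X n)"]) (auto intro: less_imp_le)
  have re: "Re (cinner z w) = Re (f w)" for w
  proof -
    define p where "p = Re (cinner z w) - Re (f w)"
    have *: "0 \<le> 2 * \<tau> * p + \<tau>\<^sup>2 * (norm w)\<^sup>2" for \<tau> :: real
    proof -
      have "F z \<le> F (z + \<tau> *\<^sub>R w)" using \<open>F z \<le> d\<close> dle order_trans by blast
      then show ?thesis
        by (simp add: F_def norm_add_square add scaleR cinner_scaleR_right p_def algebra_simps power_mult_distrib)
    qed
    \<comment> \<open>The exact minimiser of the quadratic is \<open>- p / (norm w)\<^sup>2\<close>.
      The added 1 keeps the denominator positive when \<open>w = 0\<close> and still makes the
      right-hand side of \<open>*\<close> negative unless \<open>p = 0\<close>.\<close>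
    define \<tau> where "\<tau> = - p / (1 + (norm w)\<^sup>2)"
    have n: "1 + (norm w)\<^sup>2 > 0" by (simp add: add_pos_nonneg)
    have "\<tau> * (1 + (norm w)\<^sup>2) = - p" using n by (simp add: \<tau>_def)
    then have p: "p = - \<tau> * (1 + (norm w)\<^sup>2)" by simp
    have "0 \<le> - \<tau>\<^sup>2 * (2 + (norm w)\<^sup>2)"
      using *[of \<tau>] by (simp add: p algebra_simps power2_eq_square)
    moreover have "0 \<le> \<tau>\<^sup>2 * (norm w)\<^sup>2" by simp
    ultimately have "\<tau>\<^sup>2 \<le> 0" unfolding distrib_left by linarith
    then have "\<tau> = 0" by simp
    then show ?thesis using p unfolding p_def by simp
  qed
  have "f w = cinner z w" for w
  proof (rule complex_eqI)
    show "Re (f w) = Re (cinner z w)" by (simp add: re)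
    show "Im (f w) = Im (cinner z w)" using re[of "\<i> *\<^sub>C w"] by (simp add: scale cinner_simps)
  qed
  then show ?thesis by blast
qed

section \<open>Construction of operators, and adjoints\<close>

lemma bounded_op_exists:
  fixes g :: "'h::complex_hilbert \<Rightarrow> 'h"
  assumes add: "\<And>x y. g (x + y) = g x + g y" and scale: "\<And>c x. g (c *\<^sub>C x) = c *\<^sub>C g x"
    and bound: "\<And>x. norm (g x) \<le> K * norm x"
  shows "\<exists>a. \<forall>x. op_apply a x = g x"
proof -
  have bl: "bounded_linear g"
    by (rule bounded_linear_intro[of _ K]) (use bound in \<open>simp_all add: add scaleR_scaleC scale mult.commute\<close>)
  have "op_blinfun (Abs_bounded_op (Blinfun g)) = Blinfun g"
    by (rule Abs_bounded_op_inverse) (simp add: bounded_linear_Blinfun_apply[OF bl] scale)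
  then have "op_apply (Abs_bounded_op (Blinfun g)) x = g x" for x
    by (simp add: op_apply.rep_eq bounded_linear_Blinfun_apply[OF bl])
  then show ?thesis by blast
qed

lemma norm_bounded_op_le: "0 \<le> K \<Longrightarrow> (\<And>x. norm (op_apply a x) \<le> K * norm x) \<Longrightarrow> norm a \<le> K"
  by transfer (rule norm_blinfun_bound)

text \<open>Since \<open>adj\<close> is a definite description, nothing can be said of it before
  existence and uniqueness are known. Riesz gives the value at each vector; linearity of the
  resulting map comes from uniqueness of the representing vector.\<close>

lemma cinner_adj: "cinner (op_apply (adj a) x) y = cinner x (op_apply a (y::'h::complex_hilbert))"
proof -
  have "\<exists>z. \<forall>y. cinner x (op_apply a y) = cinner z y" for x
  proof (rule riesz_representation)
    show "cmod (cinner x (op_apply a y)) \<le> (norm x * norm a) * norm y" for y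
      using order_trans[OF cmod_cinner_le mult_left_mono[OF norm_op_apply[of a y] norm_ge_zero[of x]]]
      by (simp add: mult.assoc)
  qed (simp_all add: linear_add[OF bounded_linear.linear[OF bounded_linear_op_apply]]
         op_apply_scaleC_right cinner_simps)
  then obtain g where g: "cinner x (op_apply a y) = cinner (g x) y" for x y by metis
  \<comment> \<open>Testing the defining identity at \<open>g x\<close> itself and cancelling one
    factor \<open>norm (g x)\<close>.\<close>
  have "norm (g x) \<le> norm a * norm x" for x
  proof -
    have "cmod (cinner (g x) (g x)) \<le> norm x * (norm a * norm (g x))"
      unfolding g[symmetric]
      by (rule order_trans[OF cmod_cinner_le mult_left_mono[OF norm_op_apply norm_ge_zero]])
    then have "norm (g x) * norm (g x) \<le> (norm a * norm x) * norm (g x)"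
      by (simp add: cinner_self power2_eq_square norm_mult mult_ac)
    then show ?thesis by (cases "g x = 0") auto
  qed
  moreover have "g (x + y) = g x + g y" "g (c *\<^sub>C x) = c *\<^sub>C g x" for x y c
    by (rule cinner_eqI; simp add: g[symmetric] cinner_simps)+
  ultimately obtain b where b: "op_apply b x = g x" for x
    using bounded_op_exists[of g "norm a"] by blast
  have "\<exists>!b. \<forall>\<xi> \<eta>. cinner (op_apply b \<xi>) \<eta> = cinner \<xi> (op_apply a \<eta>)"
  proof (rule ex1I[of _ b])
    show "\<forall>\<xi> \<eta>. cinner (op_apply b \<xi>) \<eta> = cinner \<xi> (op_apply a \<eta>)" by (simp add: b g)
    show "b' = b" if "\<forall>\<xi> \<eta>. cinner (op_apply b' \<xi>) \<eta> = cinner \<xi> (op_apply a \<eta>)" for b'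
      by (intro bounded_op_eqI cinner_eqI) (simp add: that b g)
  qed
  from theI'[OF this] show ?thesis unfolding adj_def by blast
qed

lemma cinner_adj_right: "cinner x (op_apply (adj a) y) = cinner (op_apply a x) (y::'h::complex_hilbert)"
  by (metis cinner_adj cinner_commute)

lemma adj_unique:
  "(\<And>x y. cinner (op_apply b x) y = cinner x (op_apply a (y::'h::complex_hilbert))) \<Longrightarrow> adj a = b"
  by (intro bounded_op_eqI cinner_eqI) (simp add: cinner_adj)

lemma adj_adj [simp]: "adj (adj a) = a"
  by (rule adj_unique) (simp add: cinner_adj_right)

lemma adj_add [simp]: "adj (a + b) = adj a + adj b"
  by (rule adj_unique) (simp add: cinner_adj cinner_simps)

lemma adj_diff [simp]: "adj (a - b) = adj a - adj b"
  by (rule adj_unique) (simp add: cinner_adj cinner_simps)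

lemma adj_mult [simp]: "adj (a * b) = adj b * adj a"
  by (rule adj_unique) (simp add: cinner_adj)

lemma adj_one [simp]: "adj 1 = 1"
  by (rule adj_unique) simp

lemma adj_zero [simp]: "adj 0 = 0"
  by (rule adj_unique) (simp add: cinner_simps)

lemma adj_scaleC [simp]: "adj (c *\<^sub>C a) = cnj c *\<^sub>C adj a"
  by (rule adj_unique) (simp add: cinner_adj cinner_simps)

lemma adj_scaleR [simp]: "adj (r *\<^sub>R a) = r *\<^sub>R adj a"
  by (rule adj_unique) (simp add: cinner_adj cinner_scaleR_left cinner_scaleR_right)

lemma adj_power: "adj (a ^ n) = adj a ^ n"
  by (induction n) (simp_all add: power_commutes)

lemma norm_adj_le: "norm (adj a) \<le> norm a"
proof (rule norm_bounded_op_le)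
  fix x
  have "cmod (cinner (op_apply (adj a) x) (op_apply (adj a) x)) \<le> norm x * (norm a * norm (op_apply (adj a) x))"
    unfolding cinner_adj by (rule order_trans[OF cmod_cinner_le mult_left_mono[OF norm_op_apply norm_ge_zero]])
  then have "norm (op_apply (adj a) x) * norm (op_apply (adj a) x) \<le> (norm a * norm x) * norm (op_apply (adj a) x)"
    by (simp add: cinner_self power2_eq_square norm_mult mult_ac)
  then show "norm (op_apply (adj a) x) \<le> norm a * norm x" by (cases "op_apply (adj a) x = 0") auto
qed simp

lemma bounded_linear_adj: "bounded_linear (adj :: 'h::complex_hilbert bounded_op \<Rightarrow> _)"
  by (rule bounded_linear_intro[of _ 1]) (simp_all add: norm_adj_le)

lemma scaleC_mult_left: "(c *\<^sub>C a) * b = c *\<^sub>C (a * (b :: 'h::complex_hilbert bounded_op))"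
  by (rule bounded_op_eqI) simp

lemma scaleC_mult_right: "a * (c *\<^sub>C b) = c *\<^sub>C (a * (b :: 'h::complex_hilbert bounded_op))"
  by (rule bounded_op_eqI) (simp add: op_apply_scaleC_right)

lemma norm_op_one_le: "norm (1 :: 'h::complex_hilbert bounded_op) \<le> 1"
  by transfer (rule norm_blinfun_id_le)

section \<open>The operator exponential\<close>

text \<open>Complex homogeneity survives limits, so these operators are a closed subspace of the
  complete space of real-linear ones. Completeness makes the exponential and the Neumann series
  converge.\<close>

instance bounded_op :: (complex_hilbert) banach
proof
  fix X :: "nat \<Rightarrow> 'a bounded_op" assume "Cauchy X"
  have d: "dist (op_blinfun a) (op_blinfun b) = dist a b" for a b :: "'a bounded_op"
    by (simp add: dist_norm norm_bounded_op.rep_eq minus_bounded_op.rep_eq)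
  have "Cauchy (\<lambda>n. op_blinfun (X n))" using \<open>Cauchy X\<close> unfolding Cauchy_def by (simp add: d)
  then obtain L where L: "(\<lambda>n. op_blinfun (X n)) \<longlonglongrightarrow> L"
    using Cauchy_convergent convergent_def by blast
  have "blinfun_apply L (c *\<^sub>C x) = c *\<^sub>C blinfun_apply L x" for c x
  proof (rule LIMSEQ_unique)
    show "(\<lambda>n. blinfun_apply (op_blinfun (X n)) (c *\<^sub>C x)) \<longlonglongrightarrow> blinfun_apply L (c *\<^sub>C x)"
      by (intro blinfun.tendsto L tendsto_const)
    show "(\<lambda>n. blinfun_apply (op_blinfun (X n)) (c *\<^sub>C x)) \<longlonglongrightarrow> c *\<^sub>C blinfun_apply L x"
      unfolding op_apply.rep_eq[symmetric] op_apply_scaleC_right unfolding op_apply.rep_eq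
      by (intro bounded_linear.tendsto[OF bounded_linear_scaleC] blinfun.tendsto L tendsto_const)
  qed
  then have "op_blinfun (Abs_bounded_op L) = L" by (intro Abs_bounded_op_inverse) simp
  then have "(\<lambda>n. op_blinfun (X n)) \<longlonglongrightarrow> op_blinfun (Abs_bounded_op L)" using L by simp
  then have "X \<longlonglongrightarrow> Abs_bounded_op L" unfolding tendsto_iff by (simp add: d)
  then show "convergent X" by (rule convergentI)
qed

lemma norm_op_power_le: "norm (a ^ n :: 'h::complex_hilbert bounded_op) \<le> norm a ^ n"
proof (induction n)
  case (Suc n)
  then show ?case
    by (simp add: order_trans[OF norm_mult_ineq mult_left_mono])
qed (simp add: norm_op_one_le)

lemma op_exp_term_le: "norm (a ^ n /\<^sub>R fact n :: 'h::complex_hilbert bounded_op) \<le> norm a ^ n /\<^sub>R fact n"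
  by (simp add: norm_op_power_le mult_left_mono)

lemma summable_norm_op_exp:
  "summable (\<lambda>n. norm (a ^ n /\<^sub>R fact n :: 'h::complex_hilbert bounded_op))"
  by (rule summable_comparison_test'[OF summable_exp_generic[of "norm a"], of 0])
     (use op_exp_term_le[where a = a] in \<open>simp only: real_norm_def abs_norm_cancel\<close>)

lemmas summable_op_exp = summable_norm_cancel[OF summable_norm_op_exp]

lemma norm_op_exp_le: "norm (op_exp a) \<le> exp (norm a)"
  unfolding op_exp_def exp_def
  by (rule order_trans[OF summable_norm[OF summable_norm_op_exp]])
     (rule suminf_le[OF op_exp_term_le summable_norm_op_exp summable_exp_generic])

text \<open>In the tail from index 2 on, replacing \<open>fact (n + 2)\<close> by the smaller
  \<open>fact n\<close> leaves \<open>(norm a)\<^sup>2\<close> times the full exponential series.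
  Only the quadratic order matters, so the factor 1/2 is given away.\<close>

lemma norm_op_exp_remainder_le: "norm (op_exp a - 1 - a) \<le> (norm a)\<^sup>2 * exp (norm a)"
proof -
  let ?f = "\<lambda>n. a ^ n /\<^sub>R fact n"
  have sn: "summable (\<lambda>n. norm (?f (n + 2)))"
    by (rule summable_ignore_initial_segment[OF summable_norm_op_exp])
  have "op_exp a - 1 - a = (\<Sum>n. ?f (n + 2))"
    unfolding op_exp_def using suminf_split_initial_segment[OF summable_op_exp[of a], of 2]
    by (simp add: numeral_2_eq_2)
  also have "norm \<dots> \<le> (\<Sum>n. (norm a)\<^sup>2 * (norm a ^ n /\<^sub>R fact n))"
  proof (rule order_trans[OF summable_norm[OF sn] suminf_le])
    show "norm (?f (n + 2)) \<le> (norm a)\<^sup>2 * (norm a ^ n /\<^sub>R fact n)" for n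
    proof -
      have "norm (?f (n + 2)) \<le> inverse (fact (n + 2)) * norm a ^ (n + 2)"
        using op_exp_term_le[of "n + 2" a] by simp
      also have "\<dots> \<le> inverse (fact n) * norm a ^ (n + 2)"
        by (intro mult_right_mono le_imp_inverse_le fact_mono) auto
      finally show ?thesis by (simp only: power_add real_scaleR_def mult_ac)
    qed
  qed (intro sn summable_mult summable_exp_generic)+
  also have "\<dots> = (norm a)\<^sup>2 * exp (norm a)"
    unfolding exp_def by (rule suminf_mult[OF summable_exp_generic])
  finally show ?thesis .
qed

text \<open>In the Cauchy product the coefficient of \<open>a ^ k\<close> is
  \<open>(1 + (-1)) ^ k / fact k\<close>, which vanishes except at \<open>k = 0\<close>. This is
  where unitarity of the flows comes from.\<close>

lemma op_exp_mult_minus: "op_exp a * op_exp (- a) = 1"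
proof -
  have m: "(- a) ^ n = (-1) ^ n *\<^sub>R a ^ n" for n
    by (induction n) auto
  have "(\<Sum>i\<le>k. (a ^ i /\<^sub>R fact i) * ((- a) ^ (k - i) /\<^sub>R fact (k - i))) = (if k = 0 then 1 else 0)" for k
  proof -
    have "(\<Sum>i\<le>k. (a ^ i /\<^sub>R fact i) * ((- a) ^ (k - i) /\<^sub>R fact (k - i)))
        = (\<Sum>i\<le>k. (real (k choose i) * 1 ^ i * (-1) ^ (k - i) / fact k) *\<^sub>R a ^ k)"
    proof (rule sum.cong[OF refl])
      fix i assume "i \<in> {..k}"
      then have "a ^ i * a ^ (k - i) = a ^ k" by (simp add: power_add[symmetric])
      moreover have "inverse (fact i) * (inverse (fact (k - i)) * (-1) ^ (k - i))
          = (real (k choose i) * 1 ^ i * (-1) ^ (k - i) / fact k)"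
        using \<open>i \<in> {..k}\<close> by (simp add: binomial_fact inverse_eq_divide)
      ultimately show "(a ^ i /\<^sub>R fact i) * ((- a) ^ (k - i) /\<^sub>R fact (k - i))
          = (real (k choose i) * 1 ^ i * (-1) ^ (k - i) / fact k) *\<^sub>R a ^ k"
        by (simp only: m mult_scaleR_left mult_scaleR_right scaleR_scaleR mult.commute[of _ "inverse (fact i)"])
    qed
    also have "\<dots> = ((\<Sum>i\<le>k. real (k choose i) * 1 ^ i * (-1) ^ (k - i)) / fact k) *\<^sub>R a ^ k"
      by (simp only: scaleR_left.sum[symmetric] sum_divide_distrib)
    also have "\<dots> = ((1 + (-1)) ^ k / fact k) *\<^sub>R a ^ k"
      by (simp only: binomial_ring)
    finally show ?thesis by (auto simp: power_0_left)
  qed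
  then have "op_exp a * op_exp (- a) = (\<Sum>k. if k = 0 then 1 else 0)"
    unfolding op_exp_def by (simp only: Cauchy_product[OF summable_norm_op_exp summable_norm_op_exp])
  also have "\<dots> = 1" using sums_single[of 0 "\<lambda>_. 1 :: 'a bounded_op"] by (simp add: sums_iff)
  finally show ?thesis .
qed

lemma adj_op_exp: "adj (op_exp a) = op_exp (adj a)"
  unfolding op_exp_def
  by (subst bounded_linear.suminf[OF bounded_linear_adj summable_op_exp]) (simp add: adj_power)

lemma op_exp_commutes:
  assumes "x * a = a * x"
  shows "x * op_exp a = op_exp a * x"
proof -
  have "x * a ^ n = a ^ n * x" for n
  proof (induction n)
    case (Suc n)
    have "x * a ^ Suc n = a * (x * a ^ n)" by (metis assms mult.assoc power_Suc)
    then show ?case by (simp add: Suc mult.assoc)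
  qed simp
  then show ?thesis
    unfolding op_exp_def
    by (simp add: suminf_mult[OF summable_op_exp, symmetric] suminf_mult2[OF summable_op_exp])
qed

section \<open>Completely bounded norms\<close>

lemma cb_norm_nonneg:
  assumes "completely_bounded T"
  shows "0 \<le> cb_norm T"
proof -
  have "mat_norm 0 (\<lambda>_ _. 0 :: 'a bounded_op) \<le> 1" by (rule mat_norm_le) (simp add: L2_set_def)
  from mat_norm_le_cb_norm[OF assms this] show ?thesis
    by (rule order_trans[OF mat_norm_nonneg])
qed

text \<open>The amplification by matrices of size one; all lower bounds on the cb norm of a
  derivation pass through it.\<close>

lemma norm_le_cb_norm:
  assumes "completely_bounded T" "norm x \<le> 1"
  shows "norm (T x) \<le> cb_norm T"
proof -
  have "mat_norm 1 (\<lambda>_ _. x) \<le> 1"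
  proof (rule mat_norm_le)
    fix \<xi> :: "nat \<Rightarrow> 'a" assume "L2_set (\<lambda>j. norm (\<xi> j)) {..<1} \<le> 1"
    then have "norm (\<xi> 0) \<le> 1" by (simp add: lessThan_Suc L2_set_insert)
    then have "norm x * norm (\<xi> 0) \<le> 1 * 1" by (intro mult_mono assms) auto
    then show "L2_set (\<lambda>i. norm (\<Sum>j<1. op_apply x (\<xi> j))) {..<1::nat} \<le> 1"
      using norm_op_apply[of x "\<xi> 0"] by (simp add: lessThan_Suc L2_set_insert)
  qed
  from mat_norm_le_cb_norm[OF assms(1) this]
  have *: "mat_norm 1 (\<lambda>_ _. T x) \<le> cb_norm T" .
  show ?thesis
  proof (rule norm_bounded_op_le[OF cb_norm_nonneg[OF assms(1)]])
    fix \<xi>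
    have "norm (op_apply (T x) \<xi>) \<le> mat_norm 1 (\<lambda>_ _. T x) * norm \<xi>"
      using mat_norm_apply[of "\<lambda>_ _. T x" "\<lambda>_. \<xi>" 1] by (simp add: lessThan_Suc L2_set_insert)
    also have "\<dots> \<le> cb_norm T * norm \<xi>" by (intro mult_right_mono *) simp
    finally show "norm (op_apply (T x) \<xi>) \<le> cb_norm T * norm \<xi>" .
  qed
qed

lemma cb_norm_mult_le: "cb_norm (\<lambda>x. u * x * v) \<le> norm u * norm v"
proof -
  have "norm u * cb_norm (\<lambda>x :: 'a bounded_op. x) * norm v \<le> norm u * 1 * norm v"
    by (intro mult_right_mono mult_left_mono completely_bounded_id) auto
  then show ?thesis using completely_bounded_mult(2)[OF completely_bounded_id(1), of u v] by simp
qed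

lemma completely_bounded_elementary: "completely_bounded (\<lambda>x. u * x * v)"
  by (rule completely_bounded_mult(1)[OF completely_bounded_id(1)])

text \<open>Multiplication by \<open>r *\<^sub>R 1\<close> gives only \<open>\<le>\<close>. The same
  inequality for the scaled map and the factor \<open>inverse r\<close> gives the converse.\<close>

lemma completely_bounded_scaleR:
  fixes T :: "'a::complex_hilbert bounded_op \<Rightarrow> 'a bounded_op"
  assumes "completely_bounded T"
  shows "completely_bounded (\<lambda>x. r *\<^sub>R T x)" and "cb_norm (\<lambda>x. r *\<^sub>R T x) = \<bar>r\<bar> * cb_norm T"
proof -
  have *: "completely_bounded (\<lambda>x. r *\<^sub>R T x) \<and> cb_norm (\<lambda>x. r *\<^sub>R T x) \<le> \<bar>r\<bar> * cb_norm T"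
    if T: "completely_bounded T" for T :: "'a bounded_op \<Rightarrow> 'a bounded_op" and r
  proof -
    have e: "(\<lambda>x. r *\<^sub>R T x) = (\<lambda>x. (r *\<^sub>R 1) * T x * 1)" by simp
    have "norm (r *\<^sub>R 1 :: 'a bounded_op) * cb_norm T * norm (1 :: 'a bounded_op) \<le> (\<bar>r\<bar> * 1) * cb_norm T * 1"
      unfolding norm_scaleR by (intro mult_mono norm_op_one_le) (auto simp: cb_norm_nonneg[OF T])
    then show ?thesis
      unfolding e using completely_bounded_mult[OF T, of "r *\<^sub>R 1" 1] by simp
  qed
  show cb: "completely_bounded (\<lambda>x. r *\<^sub>R T x)" using *[OF assms] by blast
  show "cb_norm (\<lambda>x. r *\<^sub>R T x) = \<bar>r\<bar> * cb_norm T"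
  proof (cases "r = 0")
    case True
    then show ?thesis using *[OF assms, of r] cb_norm_nonneg[OF cb] by simp
  next
    case False
    then have "cb_norm T \<le> inverse \<bar>r\<bar> * cb_norm (\<lambda>x. r *\<^sub>R T x)"
      using *[OF cb, of "inverse r"] by simp
    then have "\<bar>r\<bar> * cb_norm T \<le> cb_norm (\<lambda>x. r *\<^sub>R T x)"
      using False by (simp add: field_simps)
    then show ?thesis using *[OF assms, of r] by simp
  qed
qed

lemma completely_bounded_add:
  assumes "completely_bounded S" "completely_bounded T"
  shows "completely_bounded (\<lambda>x. S x + T x)" "cb_norm (\<lambda>x. S x + T x) \<le> cb_norm S + cb_norm T"
  using completely_bounded_diff[OF assms(1) completely_bounded_scaleR(1)[OF assms(2), of "-1"]]
    completely_bounded_scaleR(2)[OF assms(2), of "-1"] by simp_all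

lemma cb_norm_diff_abs_le:
  assumes "completely_bounded S" "completely_bounded T"
  shows "\<bar>cb_norm S - cb_norm T\<bar> \<le> cb_norm (\<lambda>x. S x - T x)"
proof -
  note d = completely_bounded_diff(1)[OF assms]
  have "cb_norm S \<le> cb_norm (\<lambda>x. S x - T x) + cb_norm T"
    using completely_bounded_add(2)[OF d assms(2)] by simp
  moreover have "cb_norm T \<le> cb_norm S + cb_norm (\<lambda>x. S x - T x)"
    using completely_bounded_diff(2)[OF assms(1) d] by simp
  ultimately show ?thesis by linarith
qed

section \<open>Self-adjoint operators and their spectrum\<close>

lemma cinner_self_adjoint: "self_adjoint a \<Longrightarrow> cinner (op_apply a x) y = cinner x (op_apply a y)"
  using cinner_adj[of a x y] by (simp add: self_adjoint_def)

lemma self_adjoint_real_shift: "self_adjoint a \<Longrightarrow> self_adjoint (a - r *\<^sub>R 1)"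
  by (simp add: self_adjoint_def)

section \<open>Numerical range and approximate eigenvalues\<close>

lemma norm_le_numerical_radius:
  assumes sa: "self_adjoint c" and K: "0 \<le> K"
    and bound: "\<And>x. \<bar>Re (cinner x (op_apply c x))\<bar> \<le> K * (norm x)\<^sup>2"
  shows "norm c \<le> K"
proof (rule norm_bounded_op_le[OF K])
  fix y
  show "norm (op_apply c y) \<le> K * norm y"
  proof (cases "op_apply c y = 0 \<or> y = 0")
    case False
    define z where "z = op_apply c y"
    \<comment> \<open>Polarisation expresses \<open>4 * Re (cinner x z)\<close> by the quadratic
      form at \<open>x + y\<close> and \<open>x - y\<close>, and the parallelogram law sums the two
      bounds to \<open>2 * K * ((norm x)\<^sup>2 + (norm y)\<^sup>2)\<close>. Giving
      \<open>x\<close> the norm of \<open>y\<close> makes this sharp.\<close>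
    define x where "x = (norm y / norm z) *\<^sub>R z"
    have nx: "norm x = norm y" using False by (simp add: x_def z_def)
    have add: "op_apply c (u + v) = op_apply c u + op_apply c v" "op_apply c (u - v) = op_apply c u - op_apply c v" for u v
      using bounded_linear.linear[OF bounded_linear_op_apply] by (auto intro: linear_add linear_diff)
    have sym: "Re (cinner y (op_apply c x)) = Re (cinner x (op_apply c y))"
      by (metis Re_cinner_commute cinner_self_adjoint sa)
    have "Re (cinner x z) = norm y / norm z * (norm z)\<^sup>2"
      by (simp add: x_def cinner_scaleR_left cinner_self)
    then have "4 * (norm y * norm z) = 4 * Re (cinner x (op_apply c y))"
      using False by (simp add: z_def power2_eq_square)
    also have "\<dots> = Re (cinner (x + y) (op_apply c (x + y))) - Re (cinner (x - y) (op_apply c (x - y)))"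
      using sym by (simp add: add cinner_simps)
    also have "\<dots> \<le> K * (norm (x + y))\<^sup>2 + K * (norm (x - y))\<^sup>2"
      using bound[of "x + y"] bound[of "x - y"] by linarith
    also have "\<dots> = 4 * (norm y * (K * norm y))"
      unfolding norm_add_square norm_diff_square nx by (simp add: algebra_simps power2_eq_square)
    finally show ?thesis using False by (simp add: z_def)
  qed (use K linear_0[OF bounded_linear.linear[OF bounded_linear_op_apply]] in auto)
qed

text \<open>\<open>M\<close> is the supremum of the numerical range. The upper bound is put in
  homogeneous form so that it can be fed to \<open>norm_le_numerical_radius\<close>; the
  approximation from below needs unit vectors.\<close>

lemma numerical_range_upper:
  fixes c :: "'h::complex_hilbert bounded_op"
  assumes "\<exists>x::'h. x \<noteq> 0"
  shows "\<exists>M. (\<forall>x. Re (cinner x (op_apply c x)) \<le> M * (norm x)\<^sup>2) \<and>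
    (\<forall>e>0. \<exists>x. norm x = 1 \<and> M - e < Re (cinner x (op_apply c x)))"
proof -
  define q where "q x = Re (cinner x (op_apply c x))" for x
  define S where "S = {x::'h. norm x = 1}"
  define M where "M = (SUP x\<in>S. q x)"
  have bd: "q x \<le> norm c" if "x \<in> S" for x
    using order_trans[OF Re_cinner_le[of x "op_apply c x"]] norm_op_apply[of c x] that
    by (simp add: q_def S_def)
  then have bdd: "bdd_above (q ` S)" by (intro bdd_aboveI2)
  obtain x0 :: 'h where "x0 \<noteq> 0" using assms by blast
  then have "(1 / norm x0) *\<^sub>R x0 \<in> S" by (simp add: S_def)
  then have ne: "S \<noteq> {}" by blast
  have "q x \<le> M * (norm x)\<^sup>2" for x
  proof (cases "x = 0")
    case False
    define y where "y = (1 / norm x) *\<^sub>R x"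
    have x: "x = norm x *\<^sub>R y" using False by (simp add: y_def)
    have "y \<in> S" using False by (simp add: S_def y_def)
    then have "q y \<le> M" unfolding M_def by (rule cSUP_upper[OF _ bdd])
    have "q x = q (norm x *\<^sub>R y)" using x by simp
    also have "\<dots> = (norm x)\<^sup>2 * q y"
      unfolding q_def linear_scale[OF bounded_linear.linear[OF bounded_linear_op_apply]]
      by (simp add: cinner_scaleR_right cinner_scaleR_left power2_eq_square del: of_real_power)
    also have "\<dots> \<le> M * (norm x)\<^sup>2"
      using \<open>q y \<le> M\<close> by (simp add: mult.commute mult_right_mono)
    finally show ?thesis .
  qed (simp add: q_def cinner_simps)
  moreover have "\<exists>x. norm x = 1 \<and> M - e < q x" if "e > 0" for e
    using less_cSUP_iff[OF ne bdd, of "M - e"] that unfolding M_def S_def by auto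
  ultimately show ?thesis unfolding q_def by blast
qed

text \<open>With midpoint \<open>\<mu>\<close> and radius \<open>r\<close> of the numerical range, \<open>\<parallel>(c - \<mu>) x\<parallel> \<le> r\<close>, while \<open>\<langle>x, (c - \<mu>) x\<rangle>\<close>
  is close to \<open>r\<close>; this forces \<open>(c - \<mu>) x\<close> to be close to \<open>r x\<close>.\<close>

lemma approximate_eigenvector:
  assumes "norm (c - \<mu> *\<^sub>R 1) \<le> r" and x: "norm x = 1"
    and e: "\<mu> + r - e < Re (cinner x (op_apply c x))"
  shows "(norm (op_apply c x - (\<mu> + r) *\<^sub>R x))\<^sup>2 \<le> 2 * r * e"
proof -
  define y where "y = op_apply c x - \<mu> *\<^sub>R x"
  have "norm y \<le> r" using norm_op_apply[of "c - \<mu> *\<^sub>R 1" x] assms(1) x by (simp add: y_def)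
  then have r: "0 \<le> r" and ny: "(norm y)\<^sup>2 \<le> r\<^sup>2"
    using norm_ge_zero order_trans by (blast, intro power_mono) auto
  have "Re (cinner y x) = Re (cinner x (op_apply c x)) - \<mu>"
    unfolding Re_cinner_commute[of y x] by (simp add: y_def cinner_simps cinner_scaleR_right cinner_self x)
  then have "r * (r - e) \<le> r * Re (cinner y x)" using e by (intro mult_left_mono r) simp
  moreover have "(norm (y - r *\<^sub>R x))\<^sup>2 = (norm y)\<^sup>2 - 2 * (r * Re (cinner y x)) + r\<^sup>2"
    by (simp add: norm_diff_square cinner_scaleR_right x)
  ultimately have "(norm (y - r *\<^sub>R x))\<^sup>2 \<le> 2 * r * e"
    using ny by (simp add: algebra_simps power2_eq_square)
  then show ?thesis by (simp add: y_def algebra_simps)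
qed

text \<open>The real part of the approximate point spectrum, that is its intersection with the real
  axis.\<close>

definition approx_eigenvalue :: "'h::complex_hilbert bounded_op \<Rightarrow> real \<Rightarrow> bool" where
  "approx_eigenvalue c z \<longleftrightarrow> (\<forall>e>0. \<exists>x. norm x = 1 \<and> norm (op_apply c x - z *\<^sub>R x) < e)"

lemma approx_eigenvalue_upper:
  assumes r: "norm (c - \<mu> *\<^sub>R 1) \<le> r"
    and ex: "\<And>e. e > 0 \<Longrightarrow> \<exists>x. norm x = 1 \<and> \<mu> + r - e < Re (cinner x (op_apply c x))"
  shows "approx_eigenvalue c (\<mu> + r)"
  unfolding approx_eigenvalue_def
proof (intro allI impI)
  fix e :: real assume e: "e > 0"
  have r0: "0 \<le> r" using r norm_ge_zero order_trans by blast
  \<comment> \<open>Chosen to make \<open>2 * r * d\<close> smaller than the square of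
    \<open>e\<close>; the added 1 covers \<open>r = 0\<close>.\<close>
  define d where "d = e\<^sup>2 / (2 * r + 1)"
  have d: "d > 0" using e r0 by (simp add: d_def)
  from ex[OF this] obtain x where x: "norm x = 1" "\<mu> + r - d < Re (cinner x (op_apply c x))" by blast
  have "(norm (op_apply c x - (\<mu> + r) *\<^sub>R x))\<^sup>2 \<le> 2 * r * d"
    by (rule approximate_eigenvector[OF r x])
  also have "\<dots> < (2 * r + 1) * d" using d by simp
  also have "\<dots> = e\<^sup>2" using r0 by (simp add: d_def)
  finally have "norm (op_apply c x - (\<mu> + r) *\<^sub>R x) < e" using e by (simp add: power_less_imp_less_base)
  then show "\<exists>x. norm x = 1 \<and> norm (op_apply c x - (\<mu> + r) *\<^sub>R x) < e" using x by blast
qed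

lemma extremal_approx_eigenvalues:
  fixes c :: "'h::complex_hilbert bounded_op"
  assumes sa: "self_adjoint c" and nz: "\<exists>x::'h. x \<noteq> 0"
  obtains \<mu> r where "norm (c - \<mu> *\<^sub>R 1) \<le> r" "approx_eigenvalue c (\<mu> + r)" "approx_eigenvalue c (\<mu> - r)"
proof -
  obtain M where M: "\<And>x. Re (cinner x (op_apply c x)) \<le> M * (norm x)\<^sup>2"
    "\<And>e. e > 0 \<Longrightarrow> \<exists>x. norm x = 1 \<and> M - e < Re (cinner x (op_apply c x))"
    using numerical_range_upper[OF nz, of c] by blast
  obtain m where m: "\<And>x. Re (cinner x (op_apply (- c) x)) \<le> m * (norm x)\<^sup>2"
    "\<And>e. e > 0 \<Longrightarrow> \<exists>x. norm x = 1 \<and> m - e < Re (cinner x (op_apply (- c) x))"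
    using numerical_range_upper[OF nz, of "- c"] by blast
  \<comment> \<open>\<open>- m\<close> is the infimum of the numerical range of \<open>c\<close>, so
    \<open>\<mu>\<close> is its midpoint and \<open>r\<close> half its length. Passing to
    \<open>- c\<close> replaces \<open>\<mu>\<close> by \<open>- \<mu>\<close> and keeps
    \<open>r\<close>, which reduces the lower end to the upper one.\<close>
  define \<mu> where "\<mu> = (M - m) / 2"
  define r where "r = (M + m) / 2"
  have M': "M = \<mu> + r" and m': "m = - \<mu> + r" by (simp_all add: \<mu>_def r_def field_simps)
  obtain x :: 'h where "norm x = 1" using M(2)[of 1] by auto
  then have "0 \<le> r" using M(1)[of x] m(1)[of x] by (simp add: r_def cinner_simps)
  have 1: "norm (c - \<mu> *\<^sub>R 1) \<le> r"
  proof (rule norm_le_numerical_radius[OF self_adjoint_real_shift[OF sa] \<open>0 \<le> r\<close>])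
    show "\<bar>Re (cinner x (op_apply (c - \<mu> *\<^sub>R 1) x))\<bar> \<le> r * (norm x)\<^sup>2" for x
      using M(1)[of x] m(1)[of x]
      by (simp add: M' m' cinner_simps cinner_scaleR_right cinner_self abs_le_iff algebra_simps)
  qed
  have "approx_eigenvalue c (\<mu> + r)"
    using approx_eigenvalue_upper[OF 1] M(2) unfolding M' by blast
  moreover have "norm (- c - (- \<mu>) *\<^sub>R 1) \<le> r" using 1 norm_minus_commute[of c "\<mu> *\<^sub>R 1"] by simp
  then have "approx_eigenvalue (- c) (- \<mu> + r)"
    using approx_eigenvalue_upper[of "- c" "- \<mu>" r] m(2) unfolding m' by blast
  then have "approx_eigenvalue c (\<mu> - r)"
    unfolding approx_eigenvalue_def
    by (metis (no_types, opaque_lifting) add.commute minus_diff_commute norm_minus_cancel op_apply_simps(5)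
        scaleR_minus_left diff_minus_eq_add minus_diff_eq uminus_add_conv_diff)
  ultimately show ?thesis using that 1 by blast
qed

section \<open>Location and diameter of the spectrum\<close>

lemma neumann_series_inverse:
  fixes x :: "'h::complex_hilbert bounded_op"
  assumes "norm x < 1"
  shows "\<exists>y. (1 - x) * y = 1 \<and> y * (1 - x) = 1"
proof -
  have sn: "summable (\<lambda>n. norm (x ^ n))"
    by (rule summable_comparison_test[OF _ summable_geometric[of "norm x"]])
       (use assms norm_op_power_le in auto)
  then have s: "summable (\<lambda>n. x ^ n)" by (rule summable_norm_cancel)
  define y where "y = (\<Sum>n. x ^ n)"
  have y: "y = 1 + (\<Sum>n. x ^ Suc n)"
    unfolding y_def using suminf_split_head[OF s] by simp
  have "x * y = (\<Sum>n. x ^ Suc n)" unfolding y_def by (simp add: suminf_mult[OF s, symmetric])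
  moreover have "y * x = (\<Sum>n. x ^ Suc n)"
    unfolding y_def by (simp add: suminf_mult2[OF s] power_commutes)
  ultimately have "(1 - x) * y = 1" "y * (1 - x) = 1"
    using y by (simp_all add: left_diff_distrib right_diff_distrib)
  then show ?thesis by blast
qed

lemma scaleC_zero_left: "0 *\<^sub>C x = (0::'h::complex_hilbert)"
  using scaleR_scaleC[of 0 x] by simp

lemma scaleC_one: "1 *\<^sub>C x = (x::'h::complex_hilbert)"
  using scaleR_scaleC[of 1 x] by simp

lemma scaleC_minus_left: "(- c) *\<^sub>C x = - (c *\<^sub>C (x::'h::complex_hilbert))"
  using scaleC_add_left[of c "- c" x] by (simp add: scaleC_zero_left add_eq_0_iff)

text \<open>Outside the disc \<open>c - z\<close> is a nonzero multiple of \<open>1 - x\<close> with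
  \<open>norm x < 1\<close>, hence invertible. A disc has diameter twice its radius, so the
  containment directly bounds \<open>diameter (spectrum c)\<close>.\<close>

lemma spectrum_subset_cball: "spectrum c \<subseteq> cball (complex_of_real \<mu>) (norm (c - \<mu> *\<^sub>R 1))"
proof
  fix z assume z: "z \<in> spectrum c"
  show "z \<in> cball (complex_of_real \<mu>) (norm (c - \<mu> *\<^sub>R 1))"
  proof (rule ccontr)
    assume nb: "\<not> ?thesis"
    define w where "w = z - \<mu>"
    have w: "norm (c - \<mu> *\<^sub>R 1) < cmod w"
      using nb by (simp add: dist_norm norm_minus_commute w_def)
    then have w0: "w \<noteq> 0" by (metis norm_ge_zero norm_zero not_less)
    define x where "x = inverse w *\<^sub>C (c - \<mu> *\<^sub>R 1)"
    have "norm x \<le> norm (c - \<mu> *\<^sub>R 1) / cmod w"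
      unfolding x_def using norm_op_scaleC[of "inverse w" "c - \<mu> *\<^sub>R 1"]
      by (simp add: norm_inverse divide_inverse mult.commute)
    also have "\<dots> < 1" using w w0 by simp
    finally obtain y where y: "(1 - x) * y = 1" "y * (1 - x) = 1"
      using neumann_series_inverse by blast
    have c: "c - z *\<^sub>C 1 = (- w) *\<^sub>C (1 - x)"
    proof (rule bounded_op_eqI)
      fix \<xi>
      have zw: "z = \<mu> + w" by (simp add: w_def)
      have "op_apply ((- w) *\<^sub>C (1 - x)) \<xi> = - (w *\<^sub>C \<xi> - (op_apply c \<xi> - \<mu> *\<^sub>R \<xi>))"
        using w0 by (simp add: x_def scaleC_minus_left scaleC_diff_right scaleC_scaleC scaleC_one)
      then show "op_apply (c - z *\<^sub>C 1) \<xi> = op_apply ((- w) *\<^sub>C (1 - x)) \<xi>"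
        by (simp add: zw scaleC_add_left scaleR_scaleC)
    qed
    have "(c - z *\<^sub>C 1) * (inverse (- w) *\<^sub>C y) = 1" "(inverse (- w) *\<^sub>C y) * (c - z *\<^sub>C 1) = 1"
      unfolding c scaleC_mult_left scaleC_mult_right y
      using w0 by (auto intro!: bounded_op_eqI simp: scaleC_scaleC scaleC_one)
    then show False using z unfolding spectrum_def by blast
  qed
qed

text \<open>A left inverse \<open>b\<close> would recover the unit vector \<open>x\<close> from the
  arbitrarily small \<open>op_apply c x - z *\<^sub>R x\<close>, which a bounded operator cannot
  do.\<close>

lemma approx_eigenvalue_in_spectrum:
  assumes "approx_eigenvalue c z"
  shows "complex_of_real z \<in> spectrum c"
proof (rule ccontr)
  assume "\<not> ?thesis"
  then obtain b where b: "b * (c - complex_of_real z *\<^sub>C 1) = 1" unfolding spectrum_def by blast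
  have "1 / (norm b + 1) > 0" by (simp add: add_nonneg_pos)
  then obtain x where x: "norm x = 1" "norm (op_apply c x - z *\<^sub>R x) < 1 / (norm b + 1)"
    using assms unfolding approx_eigenvalue_def by blast
  have "x = op_apply (b * (c - complex_of_real z *\<^sub>C 1)) x" by (simp add: b)
  then have "x = op_apply b (op_apply c x - z *\<^sub>R x)" by (simp add: scaleR_scaleC)
  then have "1 \<le> norm b * norm (op_apply c x - z *\<^sub>R x)"
    using norm_op_apply[of b "op_apply c x - z *\<^sub>R x"] x(1) by simp
  also have "\<dots> \<le> norm b * (1 / (norm b + 1))" using x(2) by (intro mult_left_mono) auto
  also have "\<dots> < 1" by (simp add: add_nonneg_pos)
  finally show False by simp
qed

lemma diameter_spectrum:
  assumes r: "norm (c - \<mu> *\<^sub>R 1) \<le> r" "approx_eigenvalue c (\<mu> + r)" "approx_eigenvalue c (\<mu> - r)"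
  shows "diameter (spectrum c) = 2 * r"
proof (rule antisym)
  have r0: "0 \<le> r" using r(1) norm_ge_zero order_trans by blast
  have sub: "spectrum c \<subseteq> cball (complex_of_real \<mu>) r"
    using spectrum_subset_cball[of c \<mu>] r(1) by (meson dual_order.trans subset_cball)
  then have "diameter (spectrum c) \<le> diameter (cball (complex_of_real \<mu>) r)"
    by (intro diameter_subset bounded_cball)
  then show "diameter (spectrum c) \<le> 2 * r" using r0 by simp
  have "dist (complex_of_real (\<mu> + r)) (complex_of_real (\<mu> - r)) \<le> diameter (spectrum c)"
    by (intro diameter_bounded_bound approx_eigenvalue_in_spectrum r bounded_subset[OF bounded_cball sub])
  then show "2 * r \<le> diameter (spectrum c)"
    using r0 by (simp add: dist_norm of_real_add[symmetric] of_real_diff[symmetric] del: of_real_add of_real_diff)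
qed

section \<open>The cb norm of an inner derivation\<close>

lemma rank_one_op:
  fixes x y :: "'h::complex_hilbert"
  shows "\<exists>T. (\<forall>z. op_apply T z = cinner y z *\<^sub>C x) \<and> norm T \<le> norm x * norm y"
proof -
  have *: "norm (cinner y z *\<^sub>C x) \<le> (norm x * norm y) * norm z" for z
    using mult_right_mono[OF cmod_cinner_le[of y z] norm_ge_zero[of x]] by (simp add: norm_scaleC mult_ac)
  obtain T where T: "\<And>z. op_apply T z = cinner y z *\<^sub>C x"
    using bounded_op_exists[of "\<lambda>z. cinner y z *\<^sub>C x", OF _ _ *]
    by (auto simp: cinner_simps scaleC_add_left scaleC_scaleC)
  then have "norm T \<le> norm x * norm y" using * by (intro norm_bounded_op_le) auto
  then show ?thesis using T by blast
qed

text \<open>Scalars are central, so the derivation does not see the shift by \<open>\<mu>\<close>,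
  and the crude bound by twice the norm may be used at the midpoint of the numerical range, where it
  is sharp.\<close>

lemma cb_norm_inner_deriv_le: "cb_norm (inner_deriv c) \<le> 2 * norm (c - \<mu> *\<^sub>R 1)"
proof -
  let ?c = "c - \<mu> *\<^sub>R 1"
  have "inner_deriv c = inner_deriv ?c"
    by (rule ext) (simp add: inner_deriv_def algebra_simps)
  moreover have "cb_norm (inner_deriv ?c) \<le> 2 * norm ?c * cb_norm (\<lambda>x :: 'a bounded_op. x)"
    by (rule completely_bounded_inner_deriv(2)[OF completely_bounded_id(1)])
  moreover have "\<dots> \<le> 2 * norm ?c * 1" by (intro mult_left_mono completely_bounded_id) simp
  ultimately show ?thesis by simp
qed

text \<open>The rank-one operators \<open>|x\<rangle>\<langle>y|\<close> between approximate eigenvectors are approximate eigenvectors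
  of the derivation, the eigenvalue being the difference.\<close>

lemma cb_norm_inner_deriv_ge:
  assumes M: "approx_eigenvalue c M" and m: "approx_eigenvalue c m"
  shows "M - m \<le> cb_norm (inner_deriv c)"
proof (rule field_le_epsilon)
  fix e :: real assume e: "e > 0"
  obtain x where x: "norm x = 1" "norm (op_apply c x - M *\<^sub>R x) < e / 2"
    using M e half_gt_zero unfolding approx_eigenvalue_def by blast
  obtain y where y: "norm y = 1" "norm (op_apply c y - m *\<^sub>R y) < e / 2"
    using m e half_gt_zero unfolding approx_eigenvalue_def by blast
  obtain T where T: "\<And>z. op_apply T z = cinner y z *\<^sub>C x" and "norm T \<le> norm x * norm y"
    using rank_one_op[of y x] by blast
  then have nT: "norm T \<le> 1" using x y by simp
  have cb: "completely_bounded (inner_deriv c)"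
    by (rule completely_bounded_inner_deriv(1)[OF completely_bounded_id(1)])
  \<comment> \<open>\<open>T\<close> sends \<open>y\<close> to \<open>x\<close> and
    \<open>op_apply c y\<close> to \<open>(m + w) *\<^sub>C x\<close>: of the error at
    \<open>y\<close> only its component \<open>w\<close> along \<open>y\<close> survives.\<close>
  define w where "w = cinner y (op_apply c y - m *\<^sub>R y)"
  have "cmod w \<le> e / 2"
    unfolding w_def using cmod_cinner_le[of y "op_apply c y - m *\<^sub>R y"] y by simp
  have wy: "cinner y (op_apply c y) = m + w"
    by (simp add: w_def cinner_simps cinner_scaleR_right cinner_self y)
  have "norm (op_apply (c * T - T * c) y) \<le> cb_norm (inner_deriv c)"
  proof -
    have "norm (op_apply (c * T - T * c) y) = norm (op_apply (inner_deriv c T) y)"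
      unfolding inner_deriv_def op_apply_scaleC norm_scaleC by simp
    also have "\<dots> \<le> norm (inner_deriv c T)" using norm_op_apply[of "inner_deriv c T" y] y by simp
    also have "\<dots> \<le> cb_norm (inner_deriv c)" by (rule norm_le_cb_norm[OF cb nT])
    finally show ?thesis .
  qed
  moreover have "op_apply (c * T - T * c) y = (M - m) *\<^sub>R x + (op_apply c x - M *\<^sub>R x) - w *\<^sub>C x"
    by (simp add: T wy cinner_self y op_apply_scaleC_right scaleC_one scaleC_add_left scaleR_scaleC[symmetric] algebra_simps)
  moreover have "M - m \<le> norm ((M - m) *\<^sub>R x)" using x by simp
  moreover have "norm (w *\<^sub>C x) \<le> e / 2" using \<open>cmod w \<le> e / 2\<close> x by (simp add: norm_scaleC)
  moreover have "norm ((M - m) *\<^sub>R x) \<le> norm ((M - m) *\<^sub>R x + (op_apply c x - M *\<^sub>R x) - w *\<^sub>C x)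
      + norm (op_apply c x - M *\<^sub>R x) + norm (w *\<^sub>C x)"
    by (smt (verit) norm_triangle_ineq4 norm_triangle_ineq add_diff_cancel diff_add_cancel)
  ultimately show "M - m \<le> cb_norm (inner_deriv c) + e" using x by simp
qed

lemma bounded_op_trivial:
  assumes "\<not> (\<exists>x::'h::complex_hilbert. x \<noteq> 0)"
  shows "(a :: 'h bounded_op) = b"
  using assms by (intro bounded_op_eqI) metis

theorem cb_norm_inner_deriv:
  fixes c :: "'h::complex_hilbert bounded_op"
  assumes "self_adjoint c"
  shows "cb_norm (inner_deriv c) = diameter (spectrum c)"
proof (cases "\<exists>x::'h. x \<noteq> 0")
  case True
  obtain \<mu> r where r: "norm (c - \<mu> *\<^sub>R 1) \<le> r" "approx_eigenvalue c (\<mu> + r)" "approx_eigenvalue c (\<mu> - r)"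
    using extremal_approx_eigenvalues[OF assms True] .
  have "cb_norm (inner_deriv c) = 2 * r"
    using cb_norm_inner_deriv_le[of c \<mu>] cb_norm_inner_deriv_ge[OF r(2,3)] r(1) by linarith
  then show ?thesis using diameter_spectrum[OF r] by simp
next
  case False
  note triv = bounded_op_trivial[OF False]
  \<comment> \<open>On the zero space every operator is invertible, so the spectrum is empty, with
    diameter 0 by convention.\<close>
  have "spectrum c = {}" unfolding spectrum_def using triv by blast
  moreover have "cb_norm (inner_deriv c) = 0"
    using cb_norm_inner_deriv_le[of c 0] triv[of c 0]
      cb_norm_nonneg[OF completely_bounded_inner_deriv(1)[OF completely_bounded_id(1), of c]] by simp
  ultimately show ?thesis by simp
qed

section \<open>Vanishing diameter and scalar commutators\<close>

lemma diameter_spectrum_eq_0: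
  fixes c :: "'h::complex_hilbert bounded_op"
  assumes "self_adjoint c" "diameter (spectrum c) = 0"
  shows "\<exists>z. c = z *\<^sub>R 1"
proof (cases "\<exists>x::'h. x \<noteq> 0")
  case True
  obtain \<mu> r where r: "norm (c - \<mu> *\<^sub>R 1) \<le> r" "approx_eigenvalue c (\<mu> + r)" "approx_eigenvalue c (\<mu> - r)"
    using extremal_approx_eigenvalues[OF assms(1) True] .
  then have "norm (c - \<mu> *\<^sub>R 1) \<le> 0" using diameter_spectrum[OF r] assms(2) by simp
  then show ?thesis by auto
qed (metis bounded_op_trivial)

text \<open>In an approximate eigenvector of \<open>a\<close> every commutator \<open>[a, b]\<close> has expectation close to 0.\<close>

lemma commutator_scalar_eq_0:
  fixes a b :: "'h::complex_hilbert bounded_op"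
  assumes sa: "self_adjoint a" and scal: "a * b - b * a = z *\<^sub>C 1"
  shows "a * b = b * a"
proof (cases "\<exists>x::'h. x \<noteq> 0")
  case True
  obtain M where M: "approx_eigenvalue a M"
    using extremal_approx_eigenvalues[OF sa True] by blast
  have "cmod z \<le> 0 + e" if "e > 0" for e
  proof -
    have "e / (2 * norm b + 1) > 0" using that by (simp add: add_nonneg_pos)
    then obtain x where x: "norm x = 1" "norm (op_apply a x - M *\<^sub>R x) < e / (2 * norm b + 1)"
      using M unfolding approx_eigenvalue_def by blast
    define y where "y = op_apply a x - M *\<^sub>R x"
    have y: "op_apply a x = M *\<^sub>R x + y" by (simp add: y_def)
    have "z = cinner x (op_apply (z *\<^sub>C 1) x)" by (simp add: cinner_simps cinner_self x)
    also have "\<dots> = cinner (op_apply a x) (op_apply b x) - cinner x (op_apply b (op_apply a x))"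
      unfolding scal[symmetric] by (simp add: cinner_simps cinner_self_adjoint[OF sa])
    \<comment> \<open>The multiples of \<open>M\<close> cancel because \<open>M\<close> is real;
      both remaining terms contain the small vector \<open>y\<close>.\<close>
    also have "\<dots> = cinner y (op_apply b x) - cinner x (op_apply b y)"
      unfolding y linear_add[OF bounded_linear.linear[OF bounded_linear_op_apply]]
        linear_scale[OF bounded_linear.linear[OF bounded_linear_op_apply]]
      by (simp add: cinner_simps cinner_scaleR_left cinner_scaleR_right)
    finally have "cmod z \<le> cmod (cinner y (op_apply b x)) + cmod (cinner x (op_apply b y))"
      using norm_triangle_ineq4[of "cinner y (op_apply b x)" "cinner x (op_apply b y)"] by simp
    also have "\<dots> \<le> norm y * norm (op_apply b x) + norm x * norm (op_apply b y)"
      by (intro add_mono cmod_cinner_le)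
    also have "\<dots> \<le> norm y * (norm b * norm x) + norm x * (norm b * norm y)"
      by (intro add_mono mult_left_mono norm_op_apply) auto
    also have "\<dots> \<le> norm y * (2 * norm b + 1)" by (simp add: x algebra_simps)
    also have "\<dots> \<le> e / (2 * norm b + 1) * (2 * norm b + 1)"
      using x(2) unfolding y_def by (intro mult_right_mono) auto
    also have "\<dots> = e" by (simp add: add_nonneg_pos[of "2 * norm b" 1] less_imp_neq[symmetric])
    finally show ?thesis by simp
  qed
  then have "cmod z \<le> 0" by (rule field_le_epsilon)
  then have "z = 0" by simp
  then have "a * b - b * a = 0" unfolding scal by (intro bounded_op_eqI) (simp add: scaleC_zero_left)
  then show ?thesis by simp
qed (metis bounded_op_trivial)

section \<open>Commutators of derivations and of flows\<close>

lemma op_apply_diff_right: "op_apply a (x - y) = op_apply a x - op_apply a y"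
  by (rule linear_diff[OF bounded_linear.linear[OF bounded_linear_op_apply]])

lemma op_apply_minus_right: "op_apply a (- x) = - op_apply a x"
  by (rule linear_neg[OF bounded_linear.linear[OF bounded_linear_op_apply]])

lemmas op_scalar_simps = op_apply_diff_right op_apply_minus_right op_apply_scaleC_right
  scaleC_diff_right scaleC_minus_right scaleC_minus_left scaleC_scaleC scaleC_one

lemma scaleC_op_add_right: "c *\<^sub>C (a + b) = c *\<^sub>C a + c *\<^sub>C (b :: 'h::complex_hilbert bounded_op)"
  by (rule bounded_op_eqI) (simp add: scaleC_add_right)

text \<open>The two factors \<open>- \<i>\<close> multiply to \<open>- 1\<close> and the Jacobi
  identity merges the double commutators; hence the order of the two terms.\<close>

lemma deriv_commutator_eq: "deriv_commutator a b x = x * (a * b - b * a) - (a * b - b * a) * x"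
  unfolding deriv_commutator_def inner_deriv_def
  by (rule bounded_op_eqI) (simp add: op_scalar_simps)

lemma deriv_commutator_eq_inner_deriv:
  "deriv_commutator a b = inner_deriv ((- \<i>) *\<^sub>C (a * b - b * a))"
  unfolding fun_eq_iff deriv_commutator_eq inner_deriv_def
  by (intro allI bounded_op_eqI) (simp add: op_scalar_simps)

lemma self_adjoint_commutator:
  assumes "self_adjoint a" "self_adjoint b"
  shows "self_adjoint ((- \<i>) *\<^sub>C (a * b - b * a))"
  using assms unfolding self_adjoint_def
  by (intro bounded_op_eqI) (simp add: op_scalar_simps)

lemma cb_norm_deriv_commutator:
  "self_adjoint a \<Longrightarrow> self_adjoint b \<Longrightarrow>
    cb_norm (deriv_commutator a b) = diameter (spectrum ((- \<i>) *\<^sub>C (a * b - b * a)))"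
  unfolding deriv_commutator_eq_inner_deriv by (intro cb_norm_inner_deriv self_adjoint_commutator)

lemma cb_norm_deriv_commutator_eq_0_iff:
  fixes a b :: "'h::complex_hilbert bounded_op"
  assumes "self_adjoint a" "self_adjoint b"
  shows "cb_norm (deriv_commutator a b) = 0 \<longleftrightarrow> a * b = b * a"
proof
  assume "cb_norm (deriv_commutator a b) = 0"
  then have "diameter (spectrum ((- \<i>) *\<^sub>C (a * b - b * a))) = 0"
    by (simp only: cb_norm_deriv_commutator[OF assms])
  from diameter_spectrum_eq_0[OF self_adjoint_commutator[OF assms] this]
  obtain z where z: "(- \<i>) *\<^sub>C (a * b - b * a) = z *\<^sub>R 1" by blast
  have "a * b - b * a = \<i> *\<^sub>C ((- \<i>) *\<^sub>C (a * b - b * a))"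
    by (rule bounded_op_eqI) (simp add: op_scalar_simps)
  also have "\<dots> = (\<i> * z) *\<^sub>C 1"
    unfolding z by (rule bounded_op_eqI) (simp add: scaleR_scaleC scaleC_scaleC)
  finally show "a * b = b * a" by (rule commutator_scalar_eq_0[OF assms(1)])
next
  assume "a * b = b * a"
  then have "deriv_commutator a b = inner_deriv (0 *\<^sub>R 1)"
    unfolding fun_eq_iff deriv_commutator_eq inner_deriv_def
    by (intro allI bounded_op_eqI) simp
  then show "cb_norm (deriv_commutator a b) = 0"
    using cb_norm_inner_deriv_le[of "0 *\<^sub>R 1 :: 'h bounded_op" 0]
      cb_norm_nonneg[OF completely_bounded_deriv_commutator(1)[of a b]] by simp
qed

section \<open>Second-order expansion of the flows\<close>

lemma norm_mult_le:
  fixes x y :: "'a::real_normed_algebra"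
  shows "norm x \<le> p \<Longrightarrow> norm y \<le> q \<Longrightarrow> norm (x * y) \<le> p * q"
  by (rule order_trans[OF norm_mult_ineq]) (auto intro: mult_mono order_trans[OF norm_ge_zero])

text \<open>The constant is chosen before \<open>a\<close> and \<open>s\<close>. This order of
  quantifiers is the source of all uniformity over unit balls.\<close>

lemma op_exp_estimates:
  fixes K :: real
  shows "\<exists>L\<ge>1. \<forall>(a::'h::complex_hilbert bounded_op) s. norm a \<le> K \<longrightarrow> \<bar>s\<bar> \<le> 1 \<longrightarrow>
    (let p = (\<i> * complex_of_real s) *\<^sub>C a; U = op_exp p in
      norm U \<le> L \<and> norm p \<le> L * \<bar>s\<bar> \<and> norm (U - 1) \<le> L * \<bar>s\<bar> \<and> norm (U - 1 - p) \<le> L * s\<^sup>2)"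
proof -
  define k where "k = \<bar>K\<bar>"
  \<comment> \<open>The summands bound \<open>p\<close>, \<open>U\<close> and the remainder, and
    their sum also covers \<open>k + k\<^sup>2 * exp k\<close>, the bound for \<open>U - 1\<close>.
    With \<open>k = \<bar>K\<bar>\<close> each summand is nonnegative whatever the sign of
    \<open>K\<close>.\<close>
  define L where "L = 1 + k + exp k + k\<^sup>2 * exp k"
  have L: "1 \<le> L" "exp k \<le> L" "k \<le> L" "k\<^sup>2 * exp k \<le> L" "k + k\<^sup>2 * exp k \<le> L"
    by (simp_all add: L_def k_def)
  have "let p = (\<i> * complex_of_real s) *\<^sub>C a; U = op_exp p in
      norm U \<le> L \<and> norm p \<le> L * \<bar>s\<bar> \<and> norm (U - 1) \<le> L * \<bar>s\<bar> \<and> norm (U - 1 - p) \<le> L * s\<^sup>2"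
    if a: "norm a \<le> K" and s: "\<bar>s\<bar> \<le> 1" for a :: "'h bounded_op" and s
  proof -
    define p where "p = (\<i> * complex_of_real s) *\<^sub>C a"
    define U where "U = op_exp p"
    have "norm p \<le> \<bar>s\<bar> * norm a"
      unfolding p_def using norm_op_scaleC[of "\<i> * complex_of_real s" a] by (simp add: norm_mult)
    also have "\<dots> \<le> \<bar>s\<bar> * k" using a by (intro mult_left_mono) (auto simp: k_def)
    finally have p: "norm p \<le> \<bar>s\<bar> * k" .
    also have "\<dots> \<le> 1 * k" using s by (intro mult_right_mono) (auto simp: k_def)
    finally have pk: "norm p \<le> k" by simp
    have "norm (U - 1 - p) \<le> (norm p)\<^sup>2 * exp (norm p)"
      unfolding U_def by (rule norm_op_exp_remainder_le)
    also have "\<dots> \<le> (\<bar>s\<bar> * k)\<^sup>2 * exp k"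
      using p pk by (intro mult_mono power_mono) auto
    also have "\<dots> = s\<^sup>2 * (k\<^sup>2 * exp k)" by (simp add: power_mult_distrib)
    finally have r: "norm (U - 1 - p) \<le> s\<^sup>2 * (k\<^sup>2 * exp k)" .
    also have "\<dots> \<le> s\<^sup>2 * L" by (intro mult_left_mono L) simp
    finally have 4: "norm (U - 1 - p) \<le> L * s\<^sup>2" by (simp add: mult.commute)
    have "norm (U - 1) \<le> norm p + norm (U - 1 - p)"
      using norm_triangle_ineq[of p "U - 1 - p"] by simp
    also have "\<dots> \<le> \<bar>s\<bar> * k + \<bar>s\<bar> * (k\<^sup>2 * exp k)"
    proof (intro add_mono p order_trans[OF r] mult_right_mono)
      show "s\<^sup>2 \<le> \<bar>s\<bar>" using mult_right_mono[OF s abs_ge_zero[of s]] by (simp add: power2_eq_square)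
    qed simp
    also have "\<dots> = \<bar>s\<bar> * (k + k\<^sup>2 * exp k)" by (simp only: distrib_left)
    also have "\<dots> \<le> \<bar>s\<bar> * L" by (intro mult_left_mono L) simp
    finally have 3: "norm (U - 1) \<le> L * \<bar>s\<bar>" by (simp add: mult.commute)
    have "\<bar>s\<bar> * k \<le> \<bar>s\<bar> * L" by (intro mult_left_mono L) simp
    with p have 2: "norm p \<le> L * \<bar>s\<bar>" by (simp add: mult.commute)
    have "norm U \<le> exp (norm p)" unfolding U_def by (rule norm_op_exp_le)
    also have "\<dots> \<le> L" using pk L(2) by (meson exp_le_cancel_iff order_trans)
    finally have 1: "norm U \<le> L" .
    show ?thesis unfolding Let_def p_def[symmetric] U_def[symmetric] using 1 2 3 4 by blast
  qed
  then show ?thesis using L(1) by blast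
qed

text \<open>With \<open>U = e\<^sup>i\<^sup>s\<^sup>a\<close>, \<open>V = e\<^sup>i\<^sup>t\<^sup>b\<close>, \<open>W = U V\<close>, \<open>W' = V U\<close>, \<open>R = W' - W\<close> and \<open>k = [a, b]\<close>, \<open>R\<close> equals
  \<open>s t k\<close> up to third order, and \<open>W'\<^sup>* x W' - W\<^sup>* x W - s t [x, k]\<close> is
  \<open>(W'\<^sup>* - 1) x R + x (R - s t k) + (R - s t k)\<^sup>* x W - s t k x (W - 1)\<close> because \<open>k\<^sup>* = - k\<close>.\<close>

lemma commutator_defect_estimate:
  fixes K :: real
  shows "\<exists>C\<ge>0. \<forall>(a::'h::complex_hilbert bounded_op) b s t.
    self_adjoint a \<longrightarrow> self_adjoint b \<longrightarrow> norm a \<le> K \<longrightarrow> norm b \<le> K \<longrightarrow> \<bar>s\<bar> \<le> 1 \<longrightarrow> \<bar>t\<bar> \<le> 1 \<longrightarrow>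
    \<bar>commutator_defect a b s t - \<bar>s * t\<bar> * cb_norm (deriv_commutator a b)\<bar> \<le> C * \<bar>s * t\<bar> * (\<bar>s\<bar> + \<bar>t\<bar>)"
proof -
  obtain L where L: "L \<ge> 1" and est: "\<And>(a::'h bounded_op) s. norm a \<le> K \<Longrightarrow> \<bar>s\<bar> \<le> 1 \<Longrightarrow>
    (let p = (\<i> * complex_of_real s) *\<^sub>C a; U = op_exp p in
      norm U \<le> L \<and> norm p \<le> L * \<bar>s\<bar> \<and> norm (U - 1) \<le> L * \<bar>s\<bar> \<and> norm (U - 1 - p) \<le> L * s\<^sup>2)"
    using op_exp_estimates[of K] by blast
  \<comment> \<open>The four summands of \<open>?T\<close> below contribute
    \<open>10 * L ^ 4\<close>, \<open>4 * L\<^sup>2\<close>, \<open>4 * L ^ 4\<close> and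
    \<open>2 * L ^ 4\<close>; since \<open>L \<ge> 1\<close> the total is at most
    \<open>20 * L ^ 4\<close>.\<close>
  have "\<bar>commutator_defect a b s t - \<bar>s * t\<bar> * cb_norm (deriv_commutator a b)\<bar> \<le> (20 * L ^ 4) * \<bar>s * t\<bar> * (\<bar>s\<bar> + \<bar>t\<bar>)"
    if sa: "self_adjoint a" "self_adjoint b" and n: "norm a \<le> K" "norm b \<le> K"
      and s: "\<bar>s\<bar> \<le> 1" and t: "\<bar>t\<bar> \<le> 1" for a b :: "'h bounded_op" and s t
  proof -
    define p q where "p = (\<i> * complex_of_real s) *\<^sub>C a" and "q = (\<i> * complex_of_real t) *\<^sub>C b"
    define U V where "U = op_exp p" and "V = op_exp q"
    note U = est[OF n(1) s, unfolded Let_def, folded p_def, folded U_def]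
    note V = est[OF n(2) t, unfolded Let_def, folded q_def, folded V_def]
    define W W' k where "W = U * V" and "W' = V * U" and "k = (s * t) *\<^sub>R (a * b - b * a)"
    define R where "R = W' - W"
    define w \<tau> where "w = \<bar>s * t\<bar>" and "\<tau> = \<bar>s\<bar> + \<bar>t\<bar>"
    have w0: "0 \<le> w" and \<tau>0: "0 \<le> \<tau>" "\<tau> \<le> 2" using s t by (simp_all add: w_def \<tau>_def)
    have L2: "L \<le> L\<^sup>2" using L by (simp add: power2_eq_square)
    have L4: "L\<^sup>2 \<le> L ^ 4" "1 \<le> L\<^sup>2" using L by (auto intro: power_increasing simp: one_le_power)
    have adjk: "adj k = - k"
      using sa by (simp add: k_def self_adjoint_def scaleR_minus_right[symmetric] del: scaleR_minus_right)
    have pq: "q * p - p * q = k"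
      unfolding p_def q_def k_def
      by (rule bounded_op_eqI) (simp add: op_scalar_simps scaleR_scaleC mult_ac)
    have nk: "norm k \<le> 2 * L\<^sup>2 * w"
    proof -
      have "norm k \<le> norm (q * p) + norm (p * q)" unfolding pq[symmetric] by (rule norm_triangle_ineq4)
      also have "\<dots> \<le> (L * \<bar>t\<bar>) * (L * \<bar>s\<bar>) + (L * \<bar>s\<bar>) * (L * \<bar>t\<bar>)"
        using U V by (intro add_mono norm_mult_le) auto
      finally show ?thesis by (simp add: w_def abs_mult power2_eq_square mult_ac)
    qed
    have nRk: "norm (R - k) \<le> 4 * L\<^sup>2 * w * \<tau>"
    proof -
      define A B where "A = U - 1 - p" and "B = V - 1 - q"
      have A: "U = 1 + p + A" and B: "V = 1 + q + B" by (simp_all add: A_def B_def)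
      have nA: "norm A \<le> L * s\<^sup>2" and nB: "norm B \<le> L * t\<^sup>2" using U V by (simp_all add: A_def B_def)
      \<comment> \<open>Terms with a factor 1 cancel in \<open>V * U - U * V\<close>, and
        \<open>q * p - p * q\<close> is \<open>k\<close>. Each remaining product has a factor of
        order at least \<open>s\<close> and one of order at least \<open>t\<close>, one of them
        quadratic, so \<open>w\<close> splits off.\<close>
      have "R - k = (q * A - A * q) + (B * p - p * B) + (B * A - A * B)"
        unfolding R_def W_def W'_def pq[symmetric] A B by (simp add: algebra_simps)
      also have "norm \<dots> \<le> (norm (q * A) + norm (A * q)) + (norm (B * p) + norm (p * B))
          + (norm (B * A) + norm (A * B))"
        by (intro order_trans[OF norm_triangle_ineq] add_mono norm_triangle_ineq4)
      also have "\<dots> \<le> ((L * \<bar>t\<bar>) * (L * s\<^sup>2) + (L * s\<^sup>2) * (L * \<bar>t\<bar>))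
          + ((L * t\<^sup>2) * (L * \<bar>s\<bar>) + (L * \<bar>s\<bar>) * (L * t\<^sup>2)) + ((L * t\<^sup>2) * (L * s\<^sup>2) + (L * s\<^sup>2) * (L * t\<^sup>2))"
        using U V nA nB by (intro add_mono norm_mult_le) auto
      also have "\<dots> = 2 * L\<^sup>2 * (w * \<tau> + (w * \<bar>t\<bar>) * \<bar>s\<bar>)"
        unfolding w_def \<tau>_def abs_mult by (simp add: algebra_simps power2_eq_square)
      also have "\<dots> \<le> 2 * L\<^sup>2 * (w * \<tau> + w * \<tau>)"
      proof (intro mult_left_mono add_left_mono)
        have "w * (\<bar>t\<bar> * \<bar>s\<bar>) \<le> w * (1 * \<tau>)"
          using t by (intro mult_left_mono mult_mono w0) (auto simp: \<tau>_def)
        then show "(w * \<bar>t\<bar>) * \<bar>s\<bar> \<le> w * \<tau>" by (simp add: mult_ac)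
      qed simp
      finally show ?thesis by (simp add: mult_ac)
    qed
    have nW: "norm W \<le> L\<^sup>2" "norm W' \<le> L\<^sup>2"
      unfolding W_def W'_def power2_eq_square using U V by (auto intro: norm_mult_le)
    have prod: "norm (X * Y - 1) \<le> L\<^sup>2 * \<tau>"
      if X: "norm (X - 1) \<le> L * x" and Y: "norm Y \<le> L" "norm (Y - 1) \<le> L * y"
        and xy: "x + y = \<tau>" "0 \<le> x" "0 \<le> y" for X Y :: "'h bounded_op" and x y
    proof -
      have "X * Y - 1 = (X - 1) * Y + (Y - 1)" by (simp add: algebra_simps)
      also have "norm \<dots> \<le> (L * x) * L + L * y"
        by (intro order_trans[OF norm_triangle_ineq] add_mono norm_mult_le X Y)
      also have "\<dots> \<le> L\<^sup>2 * x + L\<^sup>2 * y"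
        using L2 xy by (intro add_mono mult_right_mono) (auto simp: power2_eq_square)
      finally show ?thesis unfolding xy(1)[symmetric] by (simp only: distrib_left)
    qed
    have nW1: "norm (W - 1) \<le> L\<^sup>2 * \<tau>" "norm (W' - 1) \<le> L\<^sup>2 * \<tau>"
      unfolding W_def W'_def using U V prod[of U "\<bar>s\<bar>" V "\<bar>t\<bar>"] prod[of V "\<bar>t\<bar>" U "\<bar>s\<bar>"]
      by (auto simp: \<tau>_def)
    have "norm (adj W' - 1) = norm (adj (W' - 1))" by simp
    also have "\<dots> \<le> L\<^sup>2 * \<tau>" by (rule order_trans[OF norm_adj_le nW1(2)])
    finally have naW: "norm (adj W' - 1) \<le> L\<^sup>2 * \<tau>" .
    have nR: "norm R \<le> 10 * L\<^sup>2 * w"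
    proof -
      have "norm R \<le> 4 * L\<^sup>2 * w * \<tau> + 2 * L\<^sup>2 * w"
        using norm_triangle_ineq[of "R - k" k] nRk nk by simp
      also have "\<dots> \<le> 4 * L\<^sup>2 * w * 2 + 2 * L\<^sup>2 * w"
        using \<tau>0 w0 by (intro add_right_mono mult_left_mono) auto
      finally show ?thesis by (simp add: mult_ac)
    qed
    let ?D = "\<lambda>x. flow a s (flow b t x) - flow b t (flow a s x)"
    let ?E = "\<lambda>x. (s * t) *\<^sub>R deriv_commutator a b x"
    let ?T = "\<lambda>x. (adj W' - 1) * x * R + 1 * x * (R - k) + (adj (R - k) * x * W + (- k) * x * (W - 1))"
    have E: "?E x = x * k - k * x" for x
      by (simp add: deriv_commutator_eq k_def scaleR_diff_right[symmetric])
    \<comment> \<open>Conjugations compose in reverse: \<open>flow a s\<close> after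
      \<open>flow b t\<close> is \<open>Ad (V * U)\<close>, which is why \<open>W'\<close> carries
      the plus sign.\<close>
    have "?D x = adj W' * x * W' - adj W * x * W" for x
      unfolding flow_def Ad_def p_def[symmetric] q_def[symmetric] U_def[symmetric] V_def[symmetric]
        W_def W'_def by (simp add: mult.assoc)
    then have T: "?D x - ?E x = ?T x" for x
      unfolding E by (simp add: adjk R_def algebra_simps)
    have "cb_norm ?T \<le> (norm (adj W' - 1) * norm R + norm (1 :: 'h bounded_op) * norm (R - k))
        + (norm (adj (R - k)) * norm W + norm (- k) * norm (W - 1))"
      by (intro order_trans[OF completely_bounded_add(2)] add_mono cb_norm_mult_le
          completely_bounded_add(1) completely_bounded_elementary)
    also have "\<dots> \<le> ((L\<^sup>2 * \<tau>) * (10 * L\<^sup>2 * w) + 1 * (4 * L\<^sup>2 * w * \<tau>))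
        + ((4 * L\<^sup>2 * w * \<tau>) * L\<^sup>2 + (2 * L\<^sup>2 * w) * (L\<^sup>2 * \<tau>))"
      using naW nR nRk nk nW nW1 w0 \<tau>0
      by (intro add_mono mult_mono norm_op_one_le order_trans[OF norm_adj_le nRk]) auto
    also have "\<dots> = (16 * L ^ 4 + 4 * L\<^sup>2) * (w * \<tau>)"
      by (simp add: algebra_simps power4_eq_xxxx power2_eq_square)
    also have "\<dots> \<le> (20 * L ^ 4) * (w * \<tau>)"
      using L4 w0 \<tau>0 by (intro mult_right_mono) auto
    finally have "cb_norm (\<lambda>x. ?D x - ?E x) \<le> 20 * L ^ 4 * w * \<tau>"
      unfolding T by (simp add: mult.assoc)
    moreover have "cb_norm ?E = w * cb_norm (deriv_commutator a b)"
      unfolding w_def by (rule completely_bounded_scaleR(2)[OF completely_bounded_deriv_commutator(1)])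
    ultimately show ?thesis
      using cb_norm_diff_abs_le[OF completely_bounded_flow_diff(1)
          completely_bounded_scaleR(1)[OF completely_bounded_deriv_commutator(1)], of a s b t "s * t" a b]
      unfolding commutator_defect_def w_def \<tau>_def by linarith
  qed
  moreover have "0 \<le> 20 * L ^ 4" using L by simp
  ultimately show ?thesis by blast
qed

section \<open>Pointwise and uniform limits of the commutator defect\<close>

lemma commutator_defect_tendsto:
  assumes "self_adjoint a" "self_adjoint b"
  shows "((\<lambda>(s, t). commutator_defect a b s t / \<bar>s * t\<bar>) \<longlongrightarrow> cb_norm (deriv_commutator a b))
    (at (0, 0) within {(s, t). s * t \<noteq> 0})"
proof -
  obtain C where C: "C \<ge> 0" "\<And>s t. \<bar>s\<bar> \<le> 1 \<Longrightarrow> \<bar>t\<bar> \<le> 1 \<Longrightarrow>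
    \<bar>commutator_defect a b s t - \<bar>s * t\<bar> * cb_norm (deriv_commutator a b)\<bar> \<le> C * \<bar>s * t\<bar> * (\<bar>s\<bar> + \<bar>t\<bar>)"
    using commutator_defect_estimate[of "max (norm a) (norm b)"] assms by (meson max.cobounded1 max.cobounded2)
  have bound: "norm (commutator_defect a b s t / \<bar>s * t\<bar> - cb_norm (deriv_commutator a b)) \<le> C * (\<bar>s\<bar> + \<bar>t\<bar>)"
    if "\<bar>s\<bar> \<le> 1" "\<bar>t\<bar> \<le> 1" "s * t \<noteq> 0" for s t
  proof -
    have w: "\<bar>s * t\<bar> > 0" using that by simp
    have "commutator_defect a b s t / \<bar>s * t\<bar> - cb_norm (deriv_commutator a b)
        = (commutator_defect a b s t - \<bar>s * t\<bar> * cb_norm (deriv_commutator a b)) / \<bar>s * t\<bar>"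
      using w by (simp add: diff_divide_distrib)
    also have "norm \<dots> \<le> (C * \<bar>s * t\<bar> * (\<bar>s\<bar> + \<bar>t\<bar>)) / \<bar>s * t\<bar>"
      unfolding real_norm_def abs_divide abs_abs by (intro divide_right_mono C(2) that abs_ge_zero)
    also have "\<dots> = C * (\<bar>s\<bar> + \<bar>t\<bar>)" using w by simp
    finally show ?thesis .
  qed
  have "((\<lambda>x. (case x of (s, t) \<Rightarrow> commutator_defect a b s t / \<bar>s * t\<bar>) - cb_norm (deriv_commutator a b)) \<longlongrightarrow> 0)
      (at (0, 0) within {(s, t). s * t \<noteq> 0})"
  proof (rule Lim_null_comparison)
    show "\<forall>\<^sub>F x in at (0, 0) within {(s, t). s * t \<noteq> 0}.
        norm ((case x of (s, t) \<Rightarrow> commutator_defect a b s t / \<bar>s * t\<bar>) - cb_norm (deriv_commutator a b))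
        \<le> C * (\<bar>fst x\<bar> + \<bar>snd x\<bar>)"
      unfolding eventually_at
    proof (intro exI[of _ 1] conjI ballI impI)
      fix x :: "real \<times> real"
      assume x: "x \<in> {(s, t). s * t \<noteq> 0}" "x \<noteq> (0, 0) \<and> dist x (0, 0) < 1"
      have "\<bar>fst x\<bar> \<le> 1" "\<bar>snd x\<bar> \<le> 1"
        using dist_fst_le[of x "(0, 0)"] dist_snd_le[of x "(0, 0)"] x by auto
      then show "norm ((case x of (s, t) \<Rightarrow> commutator_defect a b s t / \<bar>s * t\<bar>) - cb_norm (deriv_commutator a b))
        \<le> C * (\<bar>fst x\<bar> + \<bar>snd x\<bar>)"
        using bound[of "fst x" "snd x"] x by (auto simp: split_beta)
    qed simp
    show "((\<lambda>x. C * (\<bar>fst x\<bar> + \<bar>snd x\<bar>)) \<longlongrightarrow> 0) (at (0, 0) within {(s, t). s * t \<noteq> (0::real)})"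
      by (auto intro!: tendsto_eq_intros)
  qed
  then show ?thesis by (rule LIM_zero_cancel)
qed

lemma commutator_defect_equal_times:
  "\<exists>C\<ge>0. \<forall>(a::'h::complex_hilbert bounded_op) b \<epsilon>.
    self_adjoint a \<longrightarrow> self_adjoint b \<longrightarrow> norm a \<le> 1 \<longrightarrow> norm b \<le> 1 \<longrightarrow> 0 < \<epsilon> \<longrightarrow> \<epsilon> \<le> 1 \<longrightarrow>
    \<bar>commutator_defect a b \<epsilon> \<epsilon> / \<epsilon>\<^sup>2 - cb_norm (deriv_commutator a b)\<bar> \<le> C * \<epsilon>"
proof -
  obtain C where C: "C \<ge> 0" "\<And>(a::'h bounded_op) b s t. self_adjoint a \<Longrightarrow> self_adjoint b \<Longrightarrow>
    norm a \<le> 1 \<Longrightarrow> norm b \<le> 1 \<Longrightarrow> \<bar>s\<bar> \<le> 1 \<Longrightarrow> \<bar>t\<bar> \<le> 1 \<Longrightarrow>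
    \<bar>commutator_defect a b s t - \<bar>s * t\<bar> * cb_norm (deriv_commutator a b)\<bar> \<le> C * \<bar>s * t\<bar> * (\<bar>s\<bar> + \<bar>t\<bar>)"
    using commutator_defect_estimate[of 1] by blast
  have "\<bar>commutator_defect a b \<epsilon> \<epsilon> / \<epsilon>\<^sup>2 - cb_norm (deriv_commutator a b)\<bar> \<le> (2 * C) * \<epsilon>"
    if "self_adjoint a" "self_adjoint b" "norm a \<le> 1" "norm b \<le> 1" and e: "0 < \<epsilon>" "\<epsilon> \<le> 1"
    for a b :: "'h bounded_op" and \<epsilon> :: real
  proof -
    have "commutator_defect a b \<epsilon> \<epsilon> / \<epsilon>\<^sup>2 - cb_norm (deriv_commutator a b)
        = (commutator_defect a b \<epsilon> \<epsilon> - \<epsilon>\<^sup>2 * cb_norm (deriv_commutator a b)) / \<epsilon>\<^sup>2"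
      using e by (simp add: diff_divide_distrib)
    also have "\<bar>\<dots>\<bar> = \<bar>commutator_defect a b \<epsilon> \<epsilon> - \<epsilon>\<^sup>2 * cb_norm (deriv_commutator a b)\<bar> / \<epsilon>\<^sup>2"
      by (simp add: abs_divide)
    also have "\<dots> \<le> (\<epsilon>\<^sup>2 * (2 * C * \<epsilon>)) / \<epsilon>\<^sup>2"
      using C(2)[OF that(1-4), of \<epsilon> \<epsilon>] e
      by (intro divide_right_mono) (simp_all add: power2_eq_square mult_ac)
    also have "\<dots> = 2 * C * \<epsilon>" using e by simp
    finally show ?thesis .
  qed
  then show ?thesis using C(1) by (intro exI[of _ "2 * C"]) auto
qed

lemma uniform_limit_commutator_defect:
  "uniform_limit (sa_ball M \<times> sa_ball N) (\<lambda>\<epsilon> (a, b). commutator_defect a b \<epsilon> \<epsilon> / \<epsilon>\<^sup>2)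
    (\<lambda>(a, b). cb_norm (deriv_commutator a b)) (at_right 0)"
  unfolding uniform_limit_iff
proof (intro allI impI)
  fix e :: real assume e: "e > 0"
  obtain C where C: "C \<ge> 0" "\<And>(a::'a bounded_op) b \<epsilon>.
    self_adjoint a \<Longrightarrow> self_adjoint b \<Longrightarrow> norm a \<le> 1 \<Longrightarrow> norm b \<le> 1 \<Longrightarrow> 0 < \<epsilon> \<Longrightarrow> \<epsilon> \<le> 1 \<Longrightarrow>
    \<bar>commutator_defect a b \<epsilon> \<epsilon> / \<epsilon>\<^sup>2 - cb_norm (deriv_commutator a b)\<bar> \<le> C * \<epsilon>"
    using commutator_defect_equal_times by blast
  define d where "d = min 1 (e / (C + 1))"
  have "d > 0" using e C(1) by (simp add: d_def add_nonneg_pos)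
  then have "\<forall>\<^sub>F \<epsilon> in at_right 0. \<epsilon> \<in> {0<..<d}" by (rule eventually_at_right_real)
  then show "\<forall>\<^sub>F \<epsilon> in at_right 0. \<forall>x\<in>sa_ball M \<times> sa_ball N.
      dist (case x of (a, b) \<Rightarrow> commutator_defect a b \<epsilon> \<epsilon> / \<epsilon>\<^sup>2) (case x of (a, b) \<Rightarrow> cb_norm (deriv_commutator a b)) < e"
  proof eventually_elim
    fix \<epsilon> assume "\<epsilon> \<in> {0<..<d}"
    then have \<epsilon>: "0 < \<epsilon>" "\<epsilon> \<le> 1" "\<epsilon> < e / (C + 1)" by (auto simp: d_def)
    have "\<epsilon> * (C + 1) < e" using \<epsilon>(3) C(1) by (simp add: pos_less_divide_eq add_nonneg_pos)
    then have "C * \<epsilon> < e" using \<epsilon>(1) by (simp add: algebra_simps)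
    then show "\<forall>x\<in>sa_ball M \<times> sa_ball N.
      dist (case x of (a, b) \<Rightarrow> commutator_defect a b \<epsilon> \<epsilon> / \<epsilon>\<^sup>2) (case x of (a, b) \<Rightarrow> cb_norm (deriv_commutator a b)) < e"
      using C(2)[OF _ _ _ _ \<epsilon>(1,2)] by (force simp: sa_ball_def dist_real_def)
  qed
qed

text \<open>Uniform closeness passes to suprema. It also makes \<open>f\<close> inherit an upper
  bound on \<open>S\<close> from \<open>g\<close>, so that its supremum is meaningful.\<close>

lemma scaled_SUP_diff_le:
  fixes f g :: "'a \<Rightarrow> real"
  assumes "S \<noteq> {}" "bdd_above (g ` S)" "c > 0" and fg: "\<And>x. x \<in> S \<Longrightarrow> \<bar>f x / c - g x\<bar> \<le> e"
  shows "\<bar>1 / c * (SUP x\<in>S. f x) - (SUP x\<in>S. g x)\<bar> \<le> e"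
proof -
  have f: "f x \<le> c * ((SUP x\<in>S. g x) + e)" if "x \<in> S" for x
  proof -
    have "f x / c \<le> (SUP x\<in>S. g x) + e"
      using fg[OF that] cSUP_upper[OF that assms(2)] by linarith
    then show ?thesis using \<open>c > 0\<close> by (simp add: field_simps)
  qed
  then have bdd: "bdd_above (f ` S)" by (intro bdd_aboveI2)
  have "(SUP x\<in>S. f x) \<le> c * ((SUP x\<in>S. g x) + e)" by (rule cSUP_least[OF assms(1) f])
  then have "1 / c * (SUP x\<in>S. f x) \<le> (SUP x\<in>S. g x) + e" using \<open>c > 0\<close> by (simp add: field_simps)
  moreover have "(SUP x\<in>S. g x) \<le> 1 / c * (SUP x\<in>S. f x) + e"
  proof (rule cSUP_least[OF assms(1)])
    fix x assume x: "x \<in> S"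
    have "f x / c \<le> (SUP x\<in>S. f x) / c"
      using cSUP_upper[OF x bdd] \<open>c > 0\<close> by (intro divide_right_mono) auto
    then show "g x \<le> 1 / c * (SUP x\<in>S. f x) + e" using fg[OF x] by simp
  qed
  ultimately show ?thesis by linarith
qed

lemma Gamma_vN_limit:
  assumes "0 \<in> M" "0 \<in> N"
  shows "((\<lambda>\<epsilon>. 1 / \<epsilon>\<^sup>2 * (SUP (a, b)\<in>sa_ball M \<times> sa_ball N. commutator_defect a b \<epsilon> \<epsilon>)) \<longlongrightarrow> Gamma_vN M N)
    (at_right 0)"
proof (rule tendstoI)
  fix e :: real assume "e > 0"
  \<comment> \<open>Half of \<open>e\<close>, because passing to suprema weakens \<open><\<close> to
    \<open>\<le>\<close>.\<close>
  then have e: "e / 2 > 0" by simp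
  have ne: "sa_ball M \<times> sa_ball N \<noteq> {}"
    using assms by (auto simp: sa_ball_def self_adjoint_def intro!: exI[of _ 0])
  show "\<forall>\<^sub>F \<epsilon> in at_right 0.
    dist (1 / \<epsilon>\<^sup>2 * (SUP (a, b)\<in>sa_ball M \<times> sa_ball N. commutator_defect a b \<epsilon> \<epsilon>)) (Gamma_vN M N) < e"
    using uniform_limitD[OF uniform_limit_commutator_defect e, of M N] eventually_at_right_less[of 0]
  proof eventually_elim
    fix \<epsilon> :: real
    assume *: "\<forall>x\<in>sa_ball M \<times> sa_ball N.
      dist (case x of (a, b) \<Rightarrow> commutator_defect a b \<epsilon> \<epsilon> / \<epsilon>\<^sup>2) (case x of (a, b) \<Rightarrow> cb_norm (deriv_commutator a b)) < e / 2"
      and "0 < \<epsilon>"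
    have "\<bar>1 / \<epsilon>\<^sup>2 * (SUP (a, b)\<in>sa_ball M \<times> sa_ball N. commutator_defect a b \<epsilon> \<epsilon>)
        - (SUP (a, b)\<in>sa_ball M \<times> sa_ball N. cb_norm (deriv_commutator a b))\<bar> \<le> e / 2"
      using * \<open>0 < \<epsilon>\<close>
      by (intro scaled_SUP_diff_le[OF ne bdd_above_Gamma_vN]) (auto simp: dist_real_def less_imp_le)
    then show "dist (1 / \<epsilon>\<^sup>2 * (SUP (a, b)\<in>sa_ball M \<times> sa_ball N. commutator_defect a b \<epsilon> \<epsilon>)) (Gamma_vN M N) < e"
      using \<open>e > 0\<close> by (simp add: Gamma_vN_def dist_real_def)
  qed
qed

text \<open>Convergence to a positive limit controls the relative error: the limit is used with
  accuracy \<open>\<eta>\<close> times its value. Halving \<open>d\<close> puts the square of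
  admissible \<open>(s, t)\<close> inside the disc of radius \<open>d\<close>.\<close>

lemma commutator_defect_two_sided:
  assumes sa: "self_adjoint a" "self_adjoint b" and c: "0 < cb_norm (deriv_commutator a b)" and \<eta>: "0 < \<eta>"
  shows "\<exists>\<delta>>0. \<forall>s t. 0 < \<bar>s\<bar> \<longrightarrow> \<bar>s\<bar> < \<delta> \<longrightarrow> 0 < \<bar>t\<bar> \<longrightarrow> \<bar>t\<bar> < \<delta> \<longrightarrow>
    (1 - \<eta>) * cb_norm (deriv_commutator a b) * \<bar>s * t\<bar> \<le> commutator_defect a b s t \<and>
    commutator_defect a b s t \<le> (1 + \<eta>) * cb_norm (deriv_commutator a b) * \<bar>s * t\<bar>"
proof -
  let ?c = "cb_norm (deriv_commutator a b)"
  have "\<forall>\<^sub>F x in at (0, 0) within {(s, t). s * t \<noteq> 0}.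
      dist (case x of (s, t) \<Rightarrow> commutator_defect a b s t / \<bar>s * t\<bar>) ?c < \<eta> * ?c"
    using c \<eta> by (intro tendstoD[OF commutator_defect_tendsto[OF sa]]) simp
  then obtain d where d: "d > 0" "\<And>s t. s * t \<noteq> 0 \<Longrightarrow> dist (s, t) (0, 0) < d \<Longrightarrow>
      \<bar>commutator_defect a b s t / \<bar>s * t\<bar> - ?c\<bar> < \<eta> * ?c"
    unfolding eventually_at by (auto simp: dist_real_def)
  have "(1 - \<eta>) * ?c * \<bar>s * t\<bar> \<le> commutator_defect a b s t \<and>
      commutator_defect a b s t \<le> (1 + \<eta>) * ?c * \<bar>s * t\<bar>"
    if "0 < \<bar>s\<bar>" "\<bar>s\<bar> < d / 2" "0 < \<bar>t\<bar>" "\<bar>t\<bar> < d / 2" for s t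
  proof -
    have w: "0 < \<bar>s * t\<bar>" using that by simp
    have "dist (s, t) (0, 0) \<le> \<bar>s\<bar> + \<bar>t\<bar>"
      using sqrt_sum_squares_le_sum_abs[of s t] by (simp add: dist_Pair_Pair)
    then have "\<bar>commutator_defect a b s t / \<bar>s * t\<bar> - ?c\<bar> < \<eta> * ?c" using that by (intro d(2)) auto
    then have "(1 - \<eta>) * ?c \<le> commutator_defect a b s t / \<bar>s * t\<bar>" "commutator_defect a b s t / \<bar>s * t\<bar> \<le> (1 + \<eta>) * ?c"
      unfolding left_diff_distrib distrib_right by (simp_all add: abs_less_iff)
    then show ?thesis using w by (simp add: pos_le_divide_eq pos_divide_le_eq)
  qed
  then show ?thesis using d(1) by (intro exI[of _ "d / 2"]) auto
qed

text \<open>Replacing \<open>adj U\<close> and \<open>U\<close> by 1 one at a time leaves two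
  elementary maps, each with a factor of norm \<open>O(\<bar>s\<bar>)\<close>.\<close>

lemma flow_tendsto_id: "((\<lambda>s. cb_norm (\<lambda>x. flow a s x - x)) \<longlongrightarrow> 0) (at 0)"
proof -
  obtain L where L: "L \<ge> 1" and est: "\<And>s. \<bar>s\<bar> \<le> 1 \<Longrightarrow>
    (let p = (\<i> * complex_of_real s) *\<^sub>C a; U = op_exp p in
      norm U \<le> L \<and> norm p \<le> L * \<bar>s\<bar> \<and> norm (U - 1) \<le> L * \<bar>s\<bar> \<and> norm (U - 1 - p) \<le> L * s\<^sup>2)"
    using op_exp_estimates[of "norm a"] by blast
  have bound: "norm (cb_norm (\<lambda>x. flow a s x - x)) \<le> L * \<bar>s\<bar> * L + 1 * (L * \<bar>s\<bar>)" if s: "\<bar>s\<bar> \<le> 1" for s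
  proof -
    define U where "U = op_exp ((\<i> * complex_of_real s) *\<^sub>C a)"
    have U: "norm U \<le> L" "norm (U - 1) \<le> L * \<bar>s\<bar>"
      using est[OF s] unfolding Let_def U_def[symmetric] by auto
    have "norm (adj U - 1) = norm (adj (U - 1))" by simp
    then have adjU: "norm (adj U - 1) \<le> L * \<bar>s\<bar>" using norm_adj_le[of "U - 1"] U(2) by simp
    have e: "flow a s x - x = (adj U - 1) * x * U + 1 * x * (U - 1)" for x
      unfolding flow_def Ad_def U_def[symmetric] by (simp add: algebra_simps)
    have "cb_norm (\<lambda>x. flow a s x - x) \<le> norm (adj U - 1) * norm U + norm (1 :: 'a bounded_op) * norm (U - 1)"
      unfolding e by (intro order_trans[OF completely_bounded_add(2)] add_mono cb_norm_mult_le completely_bounded_elementary)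
    also have "\<dots> \<le> L * \<bar>s\<bar> * L + 1 * (L * \<bar>s\<bar>)"
      using L by (intro add_mono mult_mono norm_op_one_le U adjU) auto
    finally show ?thesis using cb_norm_nonneg[OF completely_bounded_flow_diff(2)[of a s]] by simp
  qed
  show ?thesis
  proof (rule Lim_null_comparison)
    show "\<forall>\<^sub>F s in at 0. norm (cb_norm (\<lambda>x. flow a s x - x)) \<le> L * \<bar>s\<bar> * L + 1 * (L * \<bar>s\<bar>)"
      using bound by (auto simp: eventually_at dist_real_def intro!: exI[of _ 1])
    show "((\<lambda>s. L * \<bar>s\<bar> * L + 1 * (L * \<bar>s\<bar>)) \<longlongrightarrow> 0) (at 0)"
      by (auto intro!: tendsto_eq_intros)
  qed
qed

section \<open>Normal unital completely positive maps\<close>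

text \<open>The quadratic form of the conjugated matrix at \<open>\<xi>\<close> is that of
  \<open>X\<close> at the vectors \<open>op_apply u (\<xi> i)\<close>.\<close>

lemma completely_positive_Ad: "completely_positive (Ad u)"
proof -
  have "op_clinear (Ad u)"
    unfolding op_clinear_def Ad_def by (simp add: algebra_simps scaleC_mult_left scaleC_mult_right)
  moreover have "mat_positive n (\<lambda>i j. Ad u (X i j))" if "mat_positive n X" for n X
    using that unfolding mat_positive_def Ad_def
    by (auto simp: cinner_adj_right dest: spec[of _ "\<lambda>i. op_apply u (\<xi> i)" for \<xi>])
  ultimately show ?thesis unfolding completely_positive_def by blast
qed

text \<open>Moving \<open>u\<close> across the inner product turns the functional of
  \<open>\<xi>\<close> and \<open>\<eta>\<close> into that of their images under \<open>u\<close>,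
  which stay square-summable. Preimages of subbasic sets are therefore subbasic.\<close>

lemma normal_map_Ad: "normal_map (Ad (u :: 'h::complex_hilbert bounded_op))"
proof -
  define P where "P \<xi> \<eta> U = {x. (\<Sum>k. cinner (\<xi> k) (op_apply x (\<eta> k))) \<in> U}"
    for \<xi> \<eta> :: "nat \<Rightarrow> 'h" and U
  define B where "B = {P \<xi> \<eta> U | \<xi> \<eta> U.
      summable (\<lambda>k. (norm (\<xi> k))\<^sup>2) \<and> summable (\<lambda>k. (norm (\<eta> k))\<^sup>2) \<and> open U}"
  have uw: "ultraweak_topology = topology_generated_by B"
    unfolding ultraweak_topology_def B_def P_def ..
  have B: "P \<xi> \<eta> U \<in> B"
    if "summable (\<lambda>k. (norm (\<xi> k))\<^sup>2)" "summable (\<lambda>k. (norm (\<eta> k))\<^sup>2)" "open U" for \<xi> \<eta> U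
    unfolding B_def using that by blast
  \<comment> \<open>A generated topology lives on the union of its generators; the zero sequences
    show that this is the whole space.\<close>
  have "P (\<lambda>_. 0) (\<lambda>_. 0) UNIV \<in> B" by (rule B) simp_all
  moreover have "P (\<lambda>_. 0) (\<lambda>_. 0) UNIV = UNIV" by (simp add: P_def)
  ultimately have top: "\<Union>B = UNIV" by auto
  have su: "summable (\<lambda>k. (norm (op_apply u (\<zeta> k)))\<^sup>2)" if "summable (\<lambda>k. (norm (\<zeta> k))\<^sup>2)" for \<zeta>
  proof (rule summable_comparison_test'[OF summable_mult[OF that, of "(norm u)\<^sup>2"], of 0])
    show "norm ((norm (op_apply u (\<zeta> k)))\<^sup>2) \<le> (norm u)\<^sup>2 * (norm (\<zeta> k))\<^sup>2" for k
      using power_mono[OF norm_op_apply[of u "\<zeta> k"], of 2] by (simp add: power_mult_distrib)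
  qed
  have "openin (topology_generated_by B) (Ad u -` Y)" if Y: "Y \<in> B" for Y
  proof -
    obtain \<xi> \<eta> U where Y: "Y = P \<xi> \<eta> U"
      and s: "summable (\<lambda>k. (norm (\<xi> k))\<^sup>2)" "summable (\<lambda>k. (norm (\<eta> k))\<^sup>2)" and "open U"
      using Y unfolding B_def by blast
    have "Ad u -` Y = P (\<lambda>k. op_apply u (\<xi> k)) (\<lambda>k. op_apply u (\<eta> k)) U"
      by (auto simp: Y P_def Ad_def cinner_adj_right)
    also have "\<dots> \<in> B" by (intro B su s \<open>open U\<close>)
    finally show ?thesis by (rule topology_generated_by_Basis)
  qed
  then show ?thesis
    unfolding normal_map_def uw by (intro continuous_on_generated_topo) (simp_all add: top)
qed

text \<open>\<open>U\<close> is an isometry because \<open>adj p = - p\<close>, and it commutes with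
  whatever \<open>a\<close> commutes with. Unitality and fixing the region algebra are then one
  computation: \<open>x\<close> moves past \<open>U\<close> and \<open>adj U * U\<close>
  cancels.\<close>

lemma flow_in_NS:
  assumes a: "a \<in> dual_net A O1" "self_adjoint a"
  shows "flow a s \<in> NS A O1"
proof -
  define p where "p = (\<i> * complex_of_real s) *\<^sub>C a"
  define U where "U = op_exp p"
  have "adj p = - p"
    using a(2) unfolding p_def self_adjoint_def by (intro bounded_op_eqI) (simp add: scaleC_minus_left)
  then have "adj U * U = 1"
    unfolding U_def adj_op_exp using op_exp_mult_minus[of "- p"] by simp
  moreover have "x * U = U * x" if "x \<in> region_algebra A (causal_complement O1)" for x
    unfolding U_def
  proof (rule op_exp_commutes)
    have "a * x = x * a" using a(1) that unfolding dual_net_def commutant_def by blast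
    then show "x * p = p * x" by (simp add: p_def scaleC_mult_left scaleC_mult_right)
  qed
  ultimately have "Ad U x = x" if "x = 1 \<or> x \<in> region_algebra A (causal_complement O1)" for x
    using that unfolding Ad_def by (metis mult.assoc mult.left_neutral mult.right_neutral)
  moreover have "flow a s = Ad U" by (simp add: flow_def U_def p_def)
  ultimately show ?thesis
    unfolding NS_def using normal_map_Ad completely_positive_Ad by auto
qed

section \<open>Reduction of essential duality to self-adjoint contractions\<close>

lemma adj_vN_generated: "x \<in> vN_generated S \<Longrightarrow> adj x \<in> vN_generated S"
  unfolding vN_generated_def von_neumann_algebra_def by blast

lemma adj_commutant:
  assumes S: "\<And>y. y \<in> S \<Longrightarrow> adj y \<in> S" and x: "x \<in> commutant S"
  shows "adj x \<in> commutant S"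
  unfolding commutant_def
proof (intro CollectI ballI)
  fix y assume "y \<in> S"
  then have "x * adj y = adj y * x" using x S unfolding commutant_def by blast
  then have "adj (x * adj y) = adj (adj y * x)" by simp
  then show "adj x * y = y * adj x" by simp
qed

lemma adj_dual_net: "x \<in> dual_net A O1 \<Longrightarrow> adj x \<in> dual_net A O1"
  unfolding dual_net_def region_algebra_def by (intro adj_commutant adj_vN_generated)

lemma commutant_linear:
  shows "0 \<in> commutant S"
    and "x \<in> commutant S \<Longrightarrow> y \<in> commutant S \<Longrightarrow> x + y \<in> commutant S"
    and "x \<in> commutant S \<Longrightarrow> y \<in> commutant S \<Longrightarrow> x - y \<in> commutant S"
    and "x \<in> commutant S \<Longrightarrow> r *\<^sub>R x \<in> commutant S"
    and "x \<in> commutant S \<Longrightarrow> c *\<^sub>C x \<in> commutant S"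
  by (auto simp: commutant_def algebra_simps scaleC_mult_left scaleC_mult_right)

lemma self_adjoint_decomposition:
  assumes "x \<in> dual_net A O1"
  obtains h k where "h \<in> dual_net A O1" "self_adjoint h" "k \<in> dual_net A O1" "self_adjoint k" "x = h + \<i> *\<^sub>C k"
proof -
  have adj: "adj x \<in> dual_net A O1" by (rule adj_dual_net[OF assms])
  let ?h = "(1/2) *\<^sub>R (x + adj x)" and ?k = "(1/2) *\<^sub>R ((- \<i>) *\<^sub>C (x - adj x))"
  note dual = assms[unfolded dual_net_def] adj[unfolded dual_net_def]
  have "?h \<in> dual_net A O1"
    unfolding dual_net_def by (rule commutant_linear(4)[OF commutant_linear(2)[OF dual]])
  moreover have "?k \<in> dual_net A O1"
    unfolding dual_net_def by (rule commutant_linear(4)[OF commutant_linear(5)[OF commutant_linear(3)[OF dual]]])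
  moreover have "self_adjoint ?h" by (simp add: self_adjoint_def add.commute)
  moreover have "self_adjoint ?k"
    unfolding self_adjoint_def by (rule bounded_op_eqI) (simp add: op_scalar_simps)
  moreover have "x = ?h + \<i> *\<^sub>C ?k"
  proof (rule bounded_op_eqI)
    fix \<xi>
    have "op_apply (\<i> *\<^sub>C ?k) \<xi> = (1/2) *\<^sub>R (op_apply x \<xi> - op_apply (adj x) \<xi>)"
      by (simp add: scaleR_scaleC op_scalar_simps)
    then show "op_apply x \<xi> = op_apply (?h + \<i> *\<^sub>C ?k) \<xi>"
      by (simp add: scaleR_add_right scaleR_diff_right) (simp add: scaleR_left_distrib[symmetric])
  qed
  ultimately show ?thesis using that by blast
qed

lemma dual_nets_commute_iff:
  "(\<forall>x\<in>dual_net A O1. \<forall>y\<in>dual_net A O2. x * y = y * x) \<longleftrightarrow>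
   (\<forall>a\<in>sa_ball (dual_net A O1). \<forall>b\<in>sa_ball (dual_net A O2). a * b = b * a)"
proof
  assume ball: "\<forall>a\<in>sa_ball (dual_net A O1). \<forall>b\<in>sa_ball (dual_net A O2). a * b = b * a"
  have sa: "a * b = b * a" if a: "a \<in> dual_net A O1" "self_adjoint a" and b: "b \<in> dual_net A O2" "self_adjoint b" for a b
  proof -
    \<comment> \<open>Dividing by \<open>norm h + 1\<close> instead of \<open>norm h\<close> covers
      \<open>h = 0\<close>.\<close>
    have scale: "(1 / (norm h + 1)) *\<^sub>R h \<in> sa_ball (dual_net A O')" if "h \<in> dual_net A O'" "self_adjoint h" for h O'
      using that commutant_linear(4) unfolding sa_ball_def dual_net_def
      by (auto simp: self_adjoint_def add_nonneg_pos)
    let ?r = "1 / (norm a + 1)" and ?q = "1 / (norm b + 1)"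
    have "(?r *\<^sub>R a) * (?q *\<^sub>R b) = (?q *\<^sub>R b) * (?r *\<^sub>R a)"
      using ball scale[OF a] scale[OF b] by blast
    then have "(?r * ?q) *\<^sub>R (a * b) = (?r * ?q) *\<^sub>R (b * a)"
      by (simp only: mult_scaleR_left mult_scaleR_right scaleR_scaleR mult.commute)
    moreover have "norm a + 1 > 0" "norm b + 1 > 0" by (simp_all add: add_nonneg_pos)
    ultimately show ?thesis by (simp add: scaleR_cancel_left)
  qed
  show "\<forall>x\<in>dual_net A O1. \<forall>y\<in>dual_net A O2. x * y = y * x"
  proof (intro ballI)
    fix x y assume x: "x \<in> dual_net A O1" and y: "y \<in> dual_net A O2"
    obtain h k where hk: "h \<in> dual_net A O1" "self_adjoint h" "k \<in> dual_net A O1" "self_adjoint k" "x = h + \<i> *\<^sub>C k"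
      by (rule self_adjoint_decomposition[OF x])
    obtain m n where mn: "m \<in> dual_net A O2" "self_adjoint m" "n \<in> dual_net A O2" "self_adjoint n" "y = m + \<i> *\<^sub>C n"
      by (rule self_adjoint_decomposition[OF y])
    show "x * y = y * x"
      unfolding hk(5) mn(5)
      by (simp add: algebra_simps scaleC_mult_left scaleC_mult_right scaleC_op_add_right
          sa[OF hk(1,2) mn(1,2)] sa[OF hk(1,2) mn(3,4)] sa[OF hk(3,4) mn(1,2)] sa[OF hk(3,4) mn(3,4)])
  qed
qed (auto simp: sa_ball_def)

text \<open>A supremum of nonnegative terms vanishes exactly if every term does, given that the
  family is bounded and, by the pair \<open>(0, 0)\<close>, nonempty.\<close>

lemma Gamma_net_eq_0_iff:
  fixes A :: "'d::finite minkowski set \<Rightarrow> 'h::complex_hilbert bounded_op set"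
  shows "Gamma_net A O1 O2 = 0 \<longleftrightarrow> (\<forall>x\<in>dual_net A O1. \<forall>y\<in>dual_net A O2. x * y = y * x)"
proof -
  let ?B = "sa_ball (dual_net A O1) \<times> sa_ball (dual_net A O2)"
  let ?f = "\<lambda>(a, b). cb_norm (deriv_commutator a b)"
  have zero: "(0, 0) \<in> ?B"
    using commutant_linear(1) unfolding dual_net_def by (auto simp: sa_ball_def self_adjoint_def)
  have f0: "?f p = 0 \<longleftrightarrow> fst p * snd p = snd p * fst p" if "p \<in> ?B" for p
    using that by (auto simp: sa_ball_def cb_norm_deriv_commutator_eq_0_iff)
  have nonneg: "0 \<le> ?f p" for p :: "'h bounded_op \<times> 'h bounded_op"
    by (cases p) (simp add: cb_norm_nonneg completely_bounded_deriv_commutator)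
  have "Gamma_net A O1 O2 = 0 \<longleftrightarrow> (\<forall>p\<in>?B. ?f p = 0)"
  proof
    assume G: "Gamma_net A O1 O2 = 0"
    have "?f p \<le> 0" if "p \<in> ?B" for p
      using cSUP_upper[OF that bdd_above_Gamma_vN] G unfolding Gamma_net_def Gamma_vN_def by simp
    then show "\<forall>p\<in>?B. ?f p = 0" using nonneg antisym by blast
  next
    assume "\<forall>p\<in>?B. ?f p = 0"
    then have "(SUP p\<in>?B. ?f p) = (SUP p\<in>?B. 0)" by (intro SUP_cong) auto
    also have "\<dots> = 0" using zero by (intro cSUP_const) blast
    finally show "Gamma_net A O1 O2 = 0" unfolding Gamma_net_def Gamma_vN_def .
  qed
  then show ?thesis unfolding dual_nets_commute_iff using f0 by auto
qed

theorem theorem4p8: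
  fixes A :: "'d::finite minkowski set \<Rightarrow> 'h::complex_hilbert bounded_op set"
  assumes net: "haag_kastler_net A"
  shows
    \<comment> \<open>(i)\<close>
    "(\<forall>O1 O2 a b. spacelike_pair O1 O2
        \<longrightarrow> a \<in> dual_net A O1 \<longrightarrow> self_adjoint a \<longrightarrow> b \<in> dual_net A O2 \<longrightarrow> self_adjoint b
        \<longrightarrow> ((\<lambda>(s, t). commutator_defect a b s t / \<bar>s * t\<bar>) \<longlongrightarrow> cb_norm (deriv_commutator a b))
              (at (0, 0) within {(s, t). s * t \<noteq> 0})
          \<and> cb_norm (deriv_commutator a b) = diameter (spectrum ((- \<i>) *\<^sub>C (a * b - b * a))))
   \<and> \<comment> \<open>(ii)\<close>
     (\<forall>O1 O2. spacelike_pair O1 O2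
        \<longrightarrow> uniform_limit (sa_ball (dual_net A O1) \<times> sa_ball (dual_net A O2))
              (\<lambda>\<epsilon> (a, b). commutator_defect a b \<epsilon> \<epsilon> / \<epsilon>\<^sup>2)
              (\<lambda>(a, b). cb_norm (deriv_commutator a b)) (at_right 0)
          \<and> ((\<lambda>\<epsilon>. 1 / \<epsilon>\<^sup>2 * (SUP (a, b)\<in>sa_ball (dual_net A O1) \<times> sa_ball (dual_net A O2).
                                   commutator_defect a b \<epsilon> \<epsilon>))
               \<longlongrightarrow> Gamma_net A O1 O2) (at_right 0))
   \<and> \<comment> \<open>(iii)\<close>
     (essential_duality A \<longleftrightarrow> (\<forall>O1 O2. spacelike_pair O1 O2 \<longrightarrow> Gamma_net A O1 O2 = 0))
   \<and> \<comment> \<open>(iv)\<close>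
     (\<not> essential_duality A
        \<longrightarrow> (\<exists>O1 O2. spacelike_pair O1 O2
              \<and> (\<exists>a\<in>sa_ball (dual_net A O1). \<exists>b\<in>sa_ball (dual_net A O2).
                   let c = diameter (spectrum ((- \<i>) *\<^sub>C (a * b - b * a)))
                   in 0 < c
                    \<and> (\<forall>\<eta>\<in>{0<..<1}. \<exists>\<delta>>0. \<forall>s t. 0 < \<bar>s\<bar> \<longrightarrow> \<bar>s\<bar> < \<delta> \<longrightarrow> 0 < \<bar>t\<bar> \<longrightarrow> \<bar>t\<bar> < \<delta>
                          \<longrightarrow> (1 - \<eta>) * c * \<bar>s * t\<bar> \<le> commutator_defect a b s t
                            \<and> commutator_defect a b s t \<le> (1 + \<eta>) * c * \<bar>s * t\<bar>)
                    \<and> (\<forall>s. flow a s \<in> NS A O1)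
                    \<and> (\<forall>t. flow b t \<in> NS A O2)
                    \<and> ((\<lambda>s. cb_norm (\<lambda>x. flow a s x - x)) \<longlongrightarrow> 0) (at 0)
                    \<and> ((\<lambda>t. cb_norm (\<lambda>x. flow b t x - x)) \<longlongrightarrow> 0) (at 0))))"
proof (intro conjI allI impI)
  show "((\<lambda>(s, t). commutator_defect a b s t / \<bar>s * t\<bar>) \<longlongrightarrow> cb_norm (deriv_commutator a b))
      (at (0, 0) within {(s, t). s * t \<noteq> 0})"
    "cb_norm (deriv_commutator a b) = diameter (spectrum ((- \<i>) *\<^sub>C (a * b - b * a)))"
    if "self_adjoint a" "self_adjoint b" for a b :: "'h bounded_op"
    using commutator_defect_tendsto[OF that] cb_norm_deriv_commutator[OF that] by blast+
  fix O1 O2 :: "'d minkowski set"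
  show "uniform_limit (sa_ball (dual_net A O1) \<times> sa_ball (dual_net A O2))
      (\<lambda>\<epsilon> (a, b). commutator_defect a b \<epsilon> \<epsilon> / \<epsilon>\<^sup>2) (\<lambda>(a, b). cb_norm (deriv_commutator a b)) (at_right 0)"
    by (rule uniform_limit_commutator_defect)
  show "((\<lambda>\<epsilon>. 1 / \<epsilon>\<^sup>2 * (SUP (a, b)\<in>sa_ball (dual_net A O1) \<times> sa_ball (dual_net A O2).
      commutator_defect a b \<epsilon> \<epsilon>)) \<longlongrightarrow> Gamma_net A O1 O2) (at_right 0)"
    unfolding Gamma_net_def by (intro Gamma_vN_limit) (simp_all add: dual_net_def commutant_linear(1))
next
  show "essential_duality A \<longleftrightarrow> (\<forall>O1 O2. spacelike_pair O1 O2 \<longrightarrow> Gamma_net A O1 O2 = 0)"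
    unfolding essential_duality_def Gamma_net_eq_0_iff ..
next
  assume "\<not> essential_duality A"
  then obtain O1 O2 a b where pair: "spacelike_pair O1 O2"
    and ab: "a \<in> sa_ball (dual_net A O1)" "b \<in> sa_ball (dual_net A O2)" "a * b \<noteq> b * a"
    unfolding essential_duality_def dual_nets_commute_iff by blast
  then have sa: "self_adjoint a" "self_adjoint b" and mem: "a \<in> dual_net A O1" "b \<in> dual_net A O2"
    by (auto simp: sa_ball_def)
  \<comment> \<open>By \<open>cb_norm_deriv_commutator\<close> this number is the \<open>c\<close>
    of the statement.\<close>
  have pos: "0 < cb_norm (deriv_commutator a b)"
    using cb_norm_deriv_commutator_eq_0_iff[OF sa] ab(3)
      cb_norm_nonneg[OF completely_bounded_deriv_commutator(1)[of a b]] by linarith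
  show "\<exists>O1 O2. spacelike_pair O1 O2
      \<and> (\<exists>a\<in>sa_ball (dual_net A O1). \<exists>b\<in>sa_ball (dual_net A O2).
          let c = diameter (spectrum ((- \<i>) *\<^sub>C (a * b - b * a)))
          in 0 < c
            \<and> (\<forall>\<eta>\<in>{0<..<1}. \<exists>\<delta>>0. \<forall>s t. 0 < \<bar>s\<bar> \<longrightarrow> \<bar>s\<bar> < \<delta> \<longrightarrow> 0 < \<bar>t\<bar> \<longrightarrow> \<bar>t\<bar> < \<delta>
                \<longrightarrow> (1 - \<eta>) * c * \<bar>s * t\<bar> \<le> commutator_defect a b s t
                  \<and> commutator_defect a b s t \<le> (1 + \<eta>) * c * \<bar>s * t\<bar>)
            \<and> (\<forall>s. flow a s \<in> NS A O1)
            \<and> (\<forall>t. flow b t \<in> NS A O2)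
            \<and> ((\<lambda>s. cb_norm (\<lambda>x. flow a s x - x)) \<longlongrightarrow> 0) (at 0)
            \<and> ((\<lambda>t. cb_norm (\<lambda>x. flow b t x - x)) \<longlongrightarrow> 0) (at 0))"
    unfolding Let_def
    by (intro exI[of _ O1] exI[of _ O2] conjI pair bexI[OF _ ab(1)] bexI[OF _ ab(2)] allI ballI
        flow_in_NS mem sa flow_tendsto_id; unfold cb_norm_deriv_commutator[OF sa, symmetric];
        (rule pos | rule commutator_defect_two_sided[OF sa pos]; simp))
qed

end
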